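(* Let $d\ge3$ be an integer, $p_1,\dots,p_d\in(0,1)$, $J^d$ the first rencontre-time, $\mu=E(J^d\mid J^d<\infty)$, $t\in(1,\infty)$, and $\lambda_1,\lambda_2\in(0,1)$ arbitrary. If $p_1,\dots,p_d$ are not all the same or $d\ge6$, then, with $UB$ and $LB$ as defined in the context, $$E\left(J^d\,\Big|\,\frac{\mu}{t}<J^d<\infty\right)\le\frac{t^2}{(t-1)^2}\lim_{x\to1-}\left(\frac{UB(x;\lambda_1\mid\varphi_d'+x\varphi_d'')}{LB(x;\lambda_2\mid\varphi_d')}-\frac{LB(x;\lambda_2\mid\varphi_d')}{1+UB(x;\lambda_1\mid\varphi_d)}\right).$$
   Context: Let $\{X^j_k\}_{k\ge1}$, $j=1,\dots,d$, be independent sequences, the $j$-th consisting of i.i.d. Bernoulli random variables with success parameter $p_j$ (all mutually independent); $S^j(n)=\sum_{i=1}^nX^j_i$; $J^d=\inf\{n\ge1:S^1(n)=\dots=S^d(n)\}$ ($\inf\emptyset=\infty$). Let $q_j=1-p_j$, $Q=\prod_jq_j$, $P=\prod_jp_jq_j^{-1}$, $T=Q(1+P^{1/d})^d$, and $r_n=Q^n\sum_{k=0}^n\binom nk^dP^k$. With $[x]$ the greatest integer $\le x$, for $\alpha>0$, $\lambda\in(0,1)$ define $N(\alpha,\lambda)=\max\{[\alpha/\lambda]+1,[1/(\lambda\alpha)]+1\}$, $M(\alpha,\lambda)=\frac{\alpha+1}{\sqrt\alpha(1-\lambda)}$, $L(\alpha,\lambda)=\max\left\{\left[\left(\frac{(\alpha+1)+\sqrt{(\alpha+1)^2+4\lambda\alpha}}{2\lambda\alpha}\right)^2\right]+1,\left[\left(\frac{(\alpha+1)+\sqrt{(\alpha+1)^2+4\lambda\alpha}}{2\lambda}\right)^2\right]+1\right\}$,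 $C_1(\alpha,\lambda)=\max\left\{4,\frac{(\alpha+1)^2}{\alpha(1+\lambda\alpha)}\right\}\exp\!\left(-\frac12\frac{1+\lambda\alpha}{(1-\lambda)\alpha}\left((\alpha+1)^2+\frac{\lambda\alpha}{1+\lambda\alpha}\right)\right)$, $C_2(\alpha,\lambda)=\max\left\{4,\frac{(\alpha+1)^2}{\alpha+\lambda}\right\}\exp\!\left(-\frac12\frac{\alpha+\lambda}{(1-\lambda)\alpha^2}\left((\alpha+1)^2+\frac{\lambda\alpha^2}{\alpha+\lambda}\right)\right)$, $K(\alpha,d,\lambda)=\frac{(1-\lambda)\alpha+1}{\alpha+1}C_1^d+C_2^d$. Writing $N=N(P^{1/d},\lambda)$, $L=L(P^{1/d},\lambda)$, $M=M(P^{1/d},\lambda)$, $K=K(P^{1/d},d,\lambda)$, define for $0<x<1$: $UB(x;\lambda\mid\varphi_d)=\sum_{n=1}^{N-1}r_nx^n+\left(\frac{M}{\sqrt{2\pi}}\right)^{d-1}\sum_{n\ge N}n^{-\frac{d-1}{2}}(Tx)^n$; $LB(x;\lambda\mid\varphi_d')=\sum_{n=1}^{L-1}nr_nx^{n-1}+\left(\frac{\sqrt{2\pi}}{e^2}\right)^dK\sum_{n\ge L}n^{-\frac{d-3}{2}}x^{-1}(Tx)^n$; $UB(x;\lambda\mid\varphi_d'+x\varphi_d'')=\sum_{n=1}^{N-1}n^2r_nx^{n-1}+\left(\frac{M}{\sqrt{2\pi}}\right)^{d-1}\sum_{n\ge N}n^{-\frac{d-5}{2}}x^{-1}(Tx)^n$.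 *)

theory Defs
  imports "HOL-Probability.Probability"
begin

text \<open>X j k : k-th Bernoulli trial (k >= 1) of the j-th sequence (j in 1..d); True = success.\<close>

definition partial_sum :: "(nat \<Rightarrow> nat \<Rightarrow> 'a \<Rightarrow> bool) \<Rightarrow> nat \<Rightarrow> nat \<Rightarrow> 'a \<Rightarrow> nat" where
  "partial_sum X j n \<omega> = card {i \<in> {1..n}. X j i \<omega>}"

definition rencontre_time :: "nat \<Rightarrow> (nat \<Rightarrow> nat \<Rightarrow> 'a \<Rightarrow> bool) \<Rightarrow> 'a \<Rightarrow> enat" where
  "rencontre_time d X \<omega> =
     Inf {enat n | n. n \<ge> 1 \<and> (\<forall>i\<in>{1..d}. \<forall>j\<in>{1..d}. partial_sum X i n \<omega> = partial_sum X j n \<omega>)}"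

definition cond_exp_event :: "'a measure \<Rightarrow> ('a \<Rightarrow> ennreal) \<Rightarrow> 'a set \<Rightarrow> ennreal" where
  "cond_exp_event M f A = (\<integral>\<^sup>+ \<omega>. f \<omega> * indicator A \<omega> \<partial>M) / emeasure M A"

definition qq :: "(nat \<Rightarrow> real) \<Rightarrow> nat \<Rightarrow> real" where "qq p j = 1 - p j"
definition QQ :: "nat \<Rightarrow> (nat \<Rightarrow> real) \<Rightarrow> real" where "QQ d p = (\<Prod>j\<in>{1..d}. qq p j)"
definition PP :: "nat \<Rightarrow> (nat \<Rightarrow> real) \<Rightarrow> real" where "PP d p = (\<Prod>j\<in>{1..d}. p j / qq p j)"
definition TT :: "nat \<Rightarrow> (nat \<Rightarrow> real) \<Rightarrow> real" where
  "TT d p = QQ d p * (1 + root d (PP d p)) ^ d"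
definition rr :: "nat \<Rightarrow> (nat \<Rightarrow> real) \<Rightarrow> nat \<Rightarrow> real" where
  "rr d p n = QQ d p ^ n * (\<Sum>k=0..n. real (n choose k) ^ d * PP d p ^ k)"

definition NN :: "real \<Rightarrow> real \<Rightarrow> nat" where
  "NN \<alpha> lam = max (nat \<lfloor>\<alpha> / lam\<rfloor> + 1) (nat \<lfloor>1 / (lam * \<alpha>)\<rfloor> + 1)"
definition MM :: "real \<Rightarrow> real \<Rightarrow> real" where
  "MM \<alpha> lam = (\<alpha> + 1) / (sqrt \<alpha> * (1 - lam))"
definition LL :: "real \<Rightarrow> real \<Rightarrow> nat" where
  "LL \<alpha> lam = max
     (nat \<lfloor>(((\<alpha> + 1) + sqrt ((\<alpha> + 1)^2 + 4 * lam * \<alpha>)) / (2 * lam * \<alpha>))^2\<rfloor> + 1)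
     (nat \<lfloor>(((\<alpha> + 1) + sqrt ((\<alpha> + 1)^2 + 4 * lam * \<alpha>)) / (2 * lam))^2\<rfloor> + 1)"
definition C1 :: "real \<Rightarrow> real \<Rightarrow> real" where
  "C1 \<alpha> lam = max 4 ((\<alpha> + 1)^2 / (\<alpha> * (1 + lam * \<alpha>))) *
     exp (- (1/2) * ((1 + lam * \<alpha>) / ((1 - lam) * \<alpha>)) *
          ((\<alpha> + 1)^2 + lam * \<alpha> / (1 + lam * \<alpha>)))"
definition C2 :: "real \<Rightarrow> real \<Rightarrow> real" where
  "C2 \<alpha> lam = max 4 ((\<alpha> + 1)^2 / (\<alpha> + lam)) *
     exp (- (1/2) * ((\<alpha> + lam) / ((1 - lam) * \<alpha>^2)) *
          ((\<alpha> + 1)^2 + lam * \<alpha>^2 / (\<alpha> + lam)))"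
definition KK :: "real \<Rightarrow> nat \<Rightarrow> real \<Rightarrow> real" where
  "KK \<alpha> d lam = ((1 - lam) * \<alpha> + 1) / (\<alpha> + 1) * C1 \<alpha> lam ^ d + C2 \<alpha> lam ^ d"

definition UB_phi :: "nat \<Rightarrow> (nat \<Rightarrow> real) \<Rightarrow> real \<Rightarrow> real \<Rightarrow> real" where
  "UB_phi d p lam x =
     (let \<alpha> = root d (PP d p); N = NN \<alpha> lam; M = MM \<alpha> lam; T = TT d p in
      (\<Sum>n=1..N-1. rr d p n * x ^ n) +
      (M / sqrt (2 * pi)) ^ (d - 1) *
        (\<Sum>m. real (m + N) powr (- (real d - 1) / 2) * (T * x) ^ (m + N)))"

definition LB_dphi :: "nat \<Rightarrow> (nat \<Rightarrow> real) \<Rightarrow> real \<Rightarrow> real \<Rightarrow> real" where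
  "LB_dphi d p lam x =
     (let \<alpha> = root d (PP d p); L = LL \<alpha> lam; K = KK \<alpha> d lam; T = TT d p in
      (\<Sum>n=1..L-1. real n * rr d p n * x ^ (n - 1)) +
      (sqrt (2 * pi) / exp 2) ^ d * K *
        (\<Sum>m. real (m + L) powr (- (real d - 3) / 2) * inverse x * (T * x) ^ (m + L)))"

definition UB_dphi2 :: "nat \<Rightarrow> (nat \<Rightarrow> real) \<Rightarrow> real \<Rightarrow> real \<Rightarrow> real" where
  "UB_dphi2 d p lam x =
     (let \<alpha> = root d (PP d p); N = NN \<alpha> lam; M = MM \<alpha> lam; T = TT d p in
      (\<Sum>n=1..N-1. real n ^ 2 * rr d p n * x ^ (n - 1)) +
      (M / sqrt (2 * pi)) ^ (d - 1) *
        (\<Sum>m. real (m + N) powr (- (real d - 5) / 2) * inverse x * (T * x) ^ (m + N)))"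

end

(*
The rencontre times form a renewal process: with r_n = P(S^1(n) = ... = S^d(n)) and
f_n = P(J = n), one has r_n = f_1 r_(n-1) + ... + f_n r_0 for n > 0. Differentiating R = 1 + F R
at x = 1 gives E(J^2) / E(J) = (phi' + phi'') / phi' - 2 phi' / (1 + phi) on {J < infinity}, and
the Paley-Zygmund argument turns this ratio into the bound on E(J | mu / t < J < infinity).

It remains to bound r_n. With alpha = P^(1/d), r_n / T^n is the d-th power sum of the binomial
weights with parameter alpha / (1 + alpha). Their maximum is bounded by Stirling's formula, which
gives the upper bound; Chebyshev's inequality and power means give a lower bound that exceeds the
stated one because K <= 2 (u exp(-u/2))^d with u = (alpha + 1)^2 / alpha >= 4. If the bound for
phi' + x phi'' diverges at x = 1, the limit is infinite and nothing is left to show.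
*)
theory Submission
  imports Defs
begin

text \<open>The condition on \<open>p\<close> and \<open>d\<close> is a condition on the size of
  \<open>T\<close>. Concavity of \<open>ln\<close> gives \<open>T \<le> 1\<close>, with equality
  only if all \<open>p j\<close> agree. If \<open>T < 1\<close>, a geometric factor makes every
  bounding series converge at x = 1. If \<open>T = 1\<close>, the bounding series for phi, phi' and
  phi' + x phi'' have terms of order n^(-(d-1)/2), n^(-(d-3)/2) and n^(-(d-5)/2): the first two
  converge as soon as d \<ge> 6, the third only for d \<ge> 8. So \<open>UB_phi\<close> and
  \<open>LB_dphi\<close> always have finite limits, and the infinite limit belongs to equal
  \<open>p j\<close> with d = 6 or d = 7. A divergent \<open>suminf\<close> carries no information,
  so the bounds are treated through their limits from the left: dominated convergence where the
  series at 1 converges, large partial sums where it does not. Only these limits are compared with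
  the moment series of \<open>rr\<close>. The factor \<open>1 - lam\<close> in \<open>MM\<close>
  pays for the distance between the mean of the binomial law and its integer mode, and
  \<open>NN\<close> is the index beyond which that distance is a fraction \<open>lam\<close> at
  most.\<close>

section \<open>Stirling's formula\<close>

text \<open>Stirling's approximation without its constant: the ratio decreases to
  \<open>sqrt (2 * pi)\<close>. At n = 0 division by zero gives 0, so the facts below ask for
  \<open>n > 0\<close>.\<close>

definition stirling_ratio :: "nat \<Rightarrow> real" where
  "stirling_ratio n = fact n * exp (real n) / (real n ^ n * sqrt (real n))"

lemma stirling_ratio_pos: "n > 0 \<Longrightarrow> stirling_ratio n > 0"
  by (simp add: stirling_ratio_def)

lemma ln_stirling_ratio:
  assumes "n > 0"
  shows "ln (stirling_ratio n) = ln (fact n) + real n - (real n + 1/2) * ln (real n)"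
  using assms by (simp add: stirling_ratio_def ln_div ln_mult ln_realpow ln_sqrt algebra_simps)

lemma ln_stirling_ratio_Suc:
  assumes "n > 0"
  shows "ln (stirling_ratio n) - ln (stirling_ratio (Suc n))
    = (real n + 1/2) * (ln (real n + 1) - ln (real n)) - 1"
proof -
  have "ln (fact (Suc n) :: real) = ln (real n + 1) + ln (fact n)"
    by (simp add: ln_mult add.commute)
  then show ?thesis using assms by (simp add: ln_stirling_ratio algebra_simps)
qed

text \<open>The midpoint half of the Hermite-Hadamard inequality: 1/x is convex, so its integral
  over [n, n + 1] is at least its value 1 / (n + 1/2) at the midpoint.\<close>

lemma stirling_ratio_Suc_le:
  assumes "n > 0"
  shows "stirling_ratio (Suc n) \<le> stirling_ratio n"
proof -
  have "ln (real n + 1) - ln (real n) \<ge> 1 / (real n + 1/2)"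
    using ln_inverse_approx_ge[of "real n" "real n + 1"] assms by (simp add: field_simps)
  then have "(real n + 1/2) * (1 / (real n + 1/2)) \<le> (real n + 1/2) * (ln (real n + 1) - ln (real n))"
    by (intro mult_left_mono) auto
  then have "ln (stirling_ratio (Suc n)) \<le> ln (stirling_ratio n)"
    using ln_stirling_ratio_Suc[OF assms] by simp
  then show ?thesis using assms stirling_ratio_pos by simp
qed

lemma stirling_ratio_antimono:
  assumes "0 < m" "m \<le> n"
  shows "stirling_ratio n \<le> stirling_ratio m"
  using assms(2)
proof (induction rule: dec_induct)
  case (step k)
  then show ?case using stirling_ratio_Suc_le[of k] assms by simp
qed simp

text \<open>The trapezoidal half of the same inequality bounds each decrease of the logarithm by a
  difference of the sequence 1 / (4 n). These differences telescope to at most 1/4, which keeps the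
  limit of the ratio away from 0.\<close>

lemma stirling_ratio_lower:
  assumes "n > 0"
  shows "stirling_ratio n \<ge> exp (- 1/4) * stirling_ratio 1"
proof -
  define g where "g n = ln (stirling_ratio n) - 1 / (4 * real n)" for n
  have "g k \<le> g (Suc k)" if "k > 0" for k
  proof -
    have "ln (real k + 1) - ln (real k) \<le> 1/2 * (1 / real k + 1 / (real k + 1))"
      using ln_inverse_approx_le[of "real k" 1] that by (simp add: field_simps)
    then have "(real k + 1/2) * (ln (real k + 1) - ln (real k))
        \<le> (real k + 1/2) * (1/2 * (1 / real k + 1 / (real k + 1)))"
      by (intro mult_left_mono) auto
    also have "\<dots> = 1 + (1 / (4 * real k) - 1 / (4 * real (Suc k)))"
      using that by (simp add: divide_simps) (simp add: algebra_simps)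
    finally show ?thesis using ln_stirling_ratio_Suc[OF that] unfolding g_def by linarith
  qed
  moreover have "1 \<le> n" using assms by simp
  then have "g 1 \<le> g n"
  proof (induction rule: dec_induct)
    case (step k)
    then show ?case using calculation[of k] by simp
  qed simp
  ultimately have "ln (stirling_ratio 1) - 1/4 \<le> ln (stirling_ratio n)"
    using assms unfolding g_def by (smt (verit) divide_nonneg_nonneg of_nat_0_le_iff of_nat_1 mult.right_neutral)
  moreover have "ln (exp (- 1/4) * stirling_ratio 1) = ln (stirling_ratio 1) - 1/4"
    using stirling_ratio_pos[of 1] by (simp add: ln_mult)
  ultimately have "ln (exp (- 1/4) * stirling_ratio 1) \<le> ln (stirling_ratio n)" by simp
  then show ?thesis
    using stirling_ratio_pos[of 1] stirling_ratio_pos[OF assms] by simp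
qed

section \<open>Wallis' product and the constant in Stirling's formula\<close>

lemma wallis_prod_eq:
  "(\<Prod>k=1..n. (4*real k^2) / (4*real k^2 - 1)) = 16 ^ n * fact n ^ 4 / (fact (2*n) ^ 2 * (2 * real n + 1))"
proof (induction n)
  case (Suc n)
  have *: "4 * real (Suc n)^2 - 1 = (2 * real n + 1) * (2 * real n + 3)"
    by (simp add: power2_eq_square algebra_simps)
  have f: "fact (2 * Suc n) = (2 * real n + 2) * (2 * real n + 1) * fact (2*n)"
    by (simp add: algebra_simps)
  have g: "fact (Suc n) = (real n + 1) * fact n" by (simp add: algebra_simps)
  have "(\<Prod>k=1..Suc n. (4*real k^2) / (4*real k^2 - 1))
     = 16 ^ n * fact n ^ 4 / (fact (2*n) ^ 2 * (2 * real n + 1)) * (4 * (real n + 1)^2 / ((2 * real n + 1) * (2 * real n + 3)))"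
    using Suc * by (simp add: add.commute)
  also have "\<dots> = 16 ^ Suc n * fact (Suc n) ^ 4 / (fact (2 * Suc n) ^ 2 * (2 * real (Suc n) + 1))"
  proof -
    have "a > 0 \<Longrightarrow> x * y ^ 4 / (z\<^sup>2 * a) * (4 * b\<^sup>2 / (a * c)) = 16 * x * (b * y) ^ 4 / ((2 * b * a * z)\<^sup>2 * c)"
      if "z \<noteq> 0" "b > 0" "c > 0" for a b c x y z :: real
      using that by (simp add: field_simps power_mult_distrib power4_eq_xxxx power2_eq_square)
    from this[of "fact (2*n)" "real n + 1" "2 * real n + 3" "2 * real n + 1" "16^n" "fact n"]
    show ?thesis unfolding f g by (simp add: algebra_simps)
  qed
  finally show ?case .
qed simp

text \<open>A decreasing sequence stays above its limit c, so it remains to find c. Since c > 0, the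
  quotient s(n)^2 / s(2 n) also tends to c; all powers of n and e nearly cancel in it, and its
  square is Wallis' product times 2 (2 n + 1) / n, with limit 2 pi.\<close>

lemma stirling_ratio_ge:
  assumes "n > 0"
  shows "stirling_ratio n \<ge> sqrt (2 * pi)"
proof -
  define a where "a n = stirling_ratio (Suc n)" for n
  have dec: "decseq a"
    unfolding a_def by (auto simp: decseq_def intro: stirling_ratio_antimono)
  have bnd: "exp (- 1/4) * stirling_ratio 1 \<le> a n" for n
    unfolding a_def by (rule stirling_ratio_lower) simp
  from decseq_convergent[OF dec, of "exp (- 1/4) * stirling_ratio 1"] bnd
  obtain c where c: "a \<longlonglongrightarrow> c" "\<And>n. c \<le> a n" by blast
  have "c \<ge> exp (- 1/4) * stirling_ratio 1"
    using LIMSEQ_le_const[OF c(1)] bnd by blast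
  then have cpos: "c > 0"
    using stirling_ratio_pos[of 1] by (smt (verit) exp_gt_zero mult_pos_pos zero_less_one)
  have lim: "stirling_ratio \<longlonglongrightarrow> c"
    using c(1) unfolding a_def by (rule LIMSEQ_imp_Suc)
  have lim2: "(\<lambda>n. stirling_ratio (2 * n)) \<longlonglongrightarrow> c"
    using LIMSEQ_subseq_LIMSEQ[OF lim, of "\<lambda>n. 2 * n"] by (simp add: strict_mono_def o_def)
  have "(\<lambda>n. (stirling_ratio n ^ 2 / stirling_ratio (2 * n))^2) \<longlonglongrightarrow> (c ^ 2 / c) ^ 2"
    using cpos by (intro tendsto_intros lim lim2) auto
  moreover have "(\<lambda>n. (stirling_ratio n ^ 2 / stirling_ratio (2 * n))^2) \<longlonglongrightarrow> pi/2 * 4"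
  proof (rule Lim_transform_eventually)
    have "(\<lambda>n. 2 * (2 * real n + 1) / real n) \<longlonglongrightarrow> 4"
      by real_asymp
    then show "(\<lambda>n. (\<Prod>k=1..n. (4*real k^2) / (4*real k^2 - 1)) * (2 * (2 * real n + 1) / real n)) \<longlonglongrightarrow> pi/2 * 4"
      by (intro tendsto_intros wallis)
    show "\<forall>\<^sub>F n in sequentially. (\<Prod>k=1..n. (4*real k^2) / (4*real k^2 - 1)) * (2 * (2 * real n + 1) / real n)
        = (stirling_ratio n ^ 2 / stirling_ratio (2 * n))^2"
      using eventually_gt_at_top[of 0]
    proof eventually_elim
      case (elim n)
      have e: "exp (real (2 * n)) = exp (real n) ^ 2" by (simp add: exp_double)
      have p: "real (2 * n) ^ (2 * n) = 4 ^ n * (real n ^ n)^2" by (simp add: power_mult_distrib power_mult flip: power_even_eq)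
      have s: "sqrt (real (2 * n)) ^ 2 = 2 * real n" "sqrt (real n) ^ 4 = real n ^ 2"
        using real_sqrt_pow2[of "real n"] by (simp_all add: power4_eq_xxxx power2_eq_square)
      have "stirling_ratio n ^ 2 / stirling_ratio (2 * n)
         = fact n ^ 2 * 4 ^ n * sqrt (real (2 * n)) / (sqrt (real n) ^ 2 * fact (2 * n))"
        unfolding stirling_ratio_def e p using elim by (simp add: field_simps)
      also have "\<dots> ^ 2 = fact n ^ 4 * 16 ^ n * (2 * real n) / (real n ^ 2 * fact (2 * n) ^ 2)"
        by (simp add: power_divide power_mult_distrib s flip: power_mult)
           (simp add: power_mult flip: power_even_eq)
      finally have E: "(stirling_ratio n ^ 2 / stirling_ratio (2 * n))^2
        = fact n ^ 4 * 16 ^ n * (2 * real n) / (real n ^ 2 * fact (2 * n) ^ 2)" .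
      show ?case unfolding E wallis_prod_eq using elim by (simp add: divide_simps power2_eq_square)
    qed
  qed
  ultimately have "(c^2 / c)^2 = pi/2 * 4" by (rule LIMSEQ_unique)
  then have "c ^ 2 = 2 * pi" using cpos by (simp add: power2_eq_square)
  then have "c = sqrt (2 * pi)" using cpos by (simp add: real_sqrt_unique)
  then show ?thesis using c(2)[of "n - 1"] assms by (simp add: a_def)
qed

section \<open>Power sums of binomial weights\<close>

lemma fact_conv_stirling_ratio:
  "n > 0 \<Longrightarrow> fact n = stirling_ratio n * (real n ^ n * sqrt (real n)) / exp (real n)"
  by (simp add: stirling_ratio_def)

text \<open>Used with a = n x and with a = n (1 - x) for complementary indices; the exponents then
  add up to 0.\<close>

lemma power_le_exp_diff:
  fixes a :: real
  assumes "a \<ge> 0" "k > 0"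
  shows "(a / real k) ^ k \<le> exp (a - real k)"
proof -
  have "a / real k \<le> exp (a / real k - 1)"
    using exp_ge_add_one_self[of "a / real k - 1"] by simp
  then have "(a / real k) ^ k \<le> exp (a / real k - 1) ^ k"
    using assms by (intro power_mono) auto
  also have "\<dots> = exp (a - real k)"
    using assms by (simp add: algebra_simps flip: exp_of_nat_mult)
  finally show ?thesis .
qed

text \<open>Stirling ratios split the weight into three factors. The entropy factor (n x / k)^k (n
  (1 - x) / m)^m is at most 1, the square roots give the stated shape, and s(n) / (s(k) s(m)) \<le>
  1 / s(m) \<le> 1 / sqrt (2 pi) by monotonicity. Hence no error term appears.\<close>

lemma Bernstein_le_sqrt:
  fixes x :: real
  assumes x: "0 < x" "x < 1" and k: "0 < k" "k < n"
  shows "Bernstein n k x \<le> sqrt (real n / (2 * pi * (real k * (real n - real k))))"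
proof -
  define m where "m = n - k"
  have m: "m > 0" "n = k + m" using k by (auto simp: m_def)
  have n: "n > 0" using k by simp
  let ?s = stirling_ratio
  have sp: "?s n > 0" "?s k > 0" "?s m > 0" using stirling_ratio_pos n m k by auto
  have "Bernstein n k x = fact n / (fact k * fact m) * x ^ k * (1 - x) ^ m"
    using k by (simp add: Bernstein_def binomial_fact m_def)
  also have "\<dots> = ?s n / (?s k * ?s m) * (sqrt n / (sqrt k * sqrt m))
      * ((n * x / k) ^ k * (n * (1 - x) / m) ^ m)"
  proof -
    have e: "exp (real n) = exp (real k) * exp (real m)" by (simp add: m exp_add)
    have p: "real n ^ n = real n ^ k * real n ^ m" by (simp add: m(2) power_add)
    have q: "(n * x / k) ^ k = real n ^ k * x ^ k / real k ^ k"
      "(n * (1 - x) / m) ^ m = real n ^ m * (1 - x) ^ m / real m ^ m"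
      by (simp_all add: power_mult_distrib power_divide)
    show ?thesis
      using m(1) k sp
      unfolding q fact_conv_stirling_ratio[OF n] fact_conv_stirling_ratio[OF m(1)] fact_conv_stirling_ratio[OF k(1)] e p
      by (simp add: divide_simps)
  qed
  also have "\<dots> \<le> ?s n / (?s k * ?s m) * (sqrt n / (sqrt k * sqrt m)) * 1"
  proof (intro mult_left_mono)
    have "(n * x / k) ^ k * (n * (1 - x) / m) ^ m \<le> exp (n * x - k) * exp (n * (1 - x) - m)"
      using x m k by (intro mult_mono power_le_exp_diff) auto
    also have "\<dots> = 1" using m by (simp add: algebra_simps flip: exp_add)
    finally show "(n * x / k) ^ k * (n * (1 - x) / m) ^ m \<le> 1" .
  qed (use sp in auto)
  also have "\<dots> \<le> 1 / sqrt (2 * pi) * (sqrt n / (sqrt k * sqrt m))"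
  proof -
    have "?s n / (?s k * ?s m) \<le> ?s k / (?s k * ?s m)"
      using sp stirling_ratio_antimono[of k n] k by (intro divide_right_mono) auto
    also have "\<dots> = 1 / ?s m" using sp by simp
    also have "\<dots> \<le> 1 / sqrt (2 * pi)"
      using stirling_ratio_ge[OF m(1)] sp by (intro divide_left_mono) auto
    finally show ?thesis by (simp only: mult.right_neutral) (intro mult_right_mono, auto)
  qed
  also have "\<dots> = sqrt (real n / (2 * pi * (real k * (real n - real k))))"
    using m by (simp add: real_sqrt_divide real_sqrt_mult)
  finally show ?thesis .
qed

section \<open>The mode of the binomial law and its largest weight\<close>

lemma Bernstein_Suc:
  assumes "k < n"
  shows "Bernstein n (Suc k) x * ((real k + 1) * (1 - x)) = Bernstein n k x * ((real n - real k) * x)"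
proof -
  have "real (n choose Suc k) * (real k + 1) = real (n choose k) * (real n - real k)"
  proof -
    have "Suc k * (n choose Suc k) = (n - k) * (n choose k)"
      using assms by (metis binomial_absorption binomial_absorb_comp diff_Suc_1 )
    then have "real (Suc k * (n choose Suc k)) = real ((n - k) * (n choose k))" by (simp only:)
    then show ?thesis using assms by (simp add: of_nat_diff algebra_simps)
  qed
  moreover have "(1 - x) ^ (n - k) = (1 - x) * (1 - x) ^ (n - Suc k)"
    using assms by (metis Suc_diff_Suc power_Suc)
  ultimately show ?thesis by (simp add: Bernstein_def)
qed

text \<open>Comparing a maximal weight with its two neighbours, through the ratio of consecutive
  weights, confines its index to the interval from (n + 1) x - 1 to (n + 1) x. At m = n or m = 0 one
  neighbour is missing and the bound is immediate.\<close>

lemma Bernstein_mode: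
  assumes x: "0 < x" "x < 1"
  obtains m where "m \<le> n" "\<And>k. k \<le> n \<Longrightarrow> Bernstein n k x \<le> Bernstein n m x"
    "real n * x - (1 - x) \<le> real m" "real m \<le> real n * x + x"
proof -
  obtain m where m: "m \<in> {..n}" "\<forall>k\<in>{..n}. Bernstein n k x \<le> Bernstein n m x"
  proof -
    have "Max ((\<lambda>k. Bernstein n k x) ` {..n}) \<in> (\<lambda>k. Bernstein n k x) ` {..n}"
      by (rule Max_in) auto
    then obtain m where "m \<in> {..n}" "Max ((\<lambda>k. Bernstein n k x) ` {..n}) = Bernstein n m x"
      by blast
    then show ?thesis using that by (metis Max_ge finite_atMost finite_imageI imageI)
  qed
  have pos: "Bernstein n k x > 0" if "k \<le> n" for k using Bernstein_pos x that by blast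
  have "real n * x - (1 - x) \<le> real m"
  proof (cases "m < n")
    case True
    have "Bernstein n m x * ((real n - real m) * x) \<le> Bernstein n m x * ((real m + 1) * (1 - x))"
      unfolding Bernstein_Suc[OF True, symmetric] using m x True by (intro mult_right_mono) auto
    then have "(real n - real m) * x \<le> (real m + 1) * (1 - x)"
      using pos[of m] m by simp
    then show ?thesis by (simp add: algebra_simps)
  next
    case False
    then have "m = n" using m by simp
    moreover have "real n * x \<le> real n" using x by (simp add: mult_left_le)
    ultimately show ?thesis using x by linarith
  qed
  moreover have "real m \<le> real n * x + x"
  proof (cases m)
    case 0
    then show ?thesis using x by simp
  next
    case (Suc j)
    then have j: "j < n" using m by simp
    have "Bernstein n m x * ((real j + 1) * (1 - x)) \<le> Bernstein n m x * ((real n - real j) * x)"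
      unfolding Suc Bernstein_Suc[OF j] using m x j Suc by (intro mult_right_mono) auto
    then have "(real j + 1) * (1 - x) \<le> (real n - real j) * x"
      using pos[of m] m by simp
    then show ?thesis using Suc by (simp add: algebra_simps)
  qed
  ultimately show ?thesis using that m by auto
qed

text \<open>\<open>Bernstein_le_sqrt\<close> degenerates when k is close to 0 or n, so it is applied
  at the mode m only. The hypotheses \<open>n1\<close> and \<open>n2\<close> make the deviation of m
  from n x a fraction \<open>l\<close> at most of both n x and n (1 - x). Each of m and n - m thus
  loses a factor 1 - l, and the square root turns the two factors into one.\<close>

lemma Bernstein_le_max:
  fixes x l :: real
  assumes x: "0 < x" "x < 1" and l: "0 < l" "l < 1"
    and n1: "1 - x < l * (real n * x)" and n2: "x < l * (real n * (1 - x))" and k: "k \<le> n"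
  shows "Bernstein n k x \<le> 1 / ((1 - l) * sqrt (2 * pi * (real n * (x * (1 - x)))))"
proof -
  obtain m where m: "m \<le> n" "\<And>k. k \<le> n \<Longrightarrow> Bernstein n k x \<le> Bernstein n m x"
    "real n * x - (1 - x) \<le> real m" "real m \<le> real n * x + x"
    using Bernstein_mode[OF x] by blast
  have npos: "real n > 0" using n1 x l by (cases n) auto
  have m1: "(1 - l) * (real n * x) \<le> real m"
    using m(3) n1 by (simp add: algebra_simps)
  have m2: "(1 - l) * (real n * (1 - x)) \<le> real n - real m"
    using m(4) n2 by (simp add: algebra_simps)
  have "0 < (1 - l) * (real n * x)" "0 < (1 - l) * (real n * (1 - x))"
    using x l npos by auto
  then have mm: "0 < m" "m < n" using m1 m2 by auto
  have "Bernstein n k x \<le> sqrt (real n / (2 * pi * (real m * (real n - real m))))"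
    using m(2)[OF k] Bernstein_le_sqrt[OF x mm] by linarith
  also have "\<dots> \<le> sqrt (real n / (2 * pi * (((1 - l) * (real n * x)) * ((1 - l) * (real n * (1 - x))))))"
    using m1 m2 mm x l npos
    by (intro real_sqrt_le_mono divide_left_mono mult_left_mono mult_mono mult_pos_pos) auto
  also have "real n / (2 * pi * (((1 - l) * (real n * x)) * ((1 - l) * (real n * (1 - x)))))
      = 1 / ((1 - l)^2 * (2 * pi * (real n * (x * (1 - x)))))"
  proof -
    have "N / (2 * P * ((h * (N * a)) * (h * (N * b)))) = 1 / (h^2 * (2 * P * (N * (a * b))))"
      if "N > 0" for N P h a b :: real
      using that by (simp add: divide_simps power2_eq_square)
    then show ?thesis using npos by blast
  qed
  also have "sqrt \<dots> = 1 / ((1 - l) * sqrt (2 * pi * (real n * (x * (1 - x)))))"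
    using l by (simp add: real_sqrt_divide real_sqrt_mult)
  finally show ?thesis .
qed

text \<open>One factor of each power is kept as a probability, and these sum to 1; only the other
  \<open>e\<close> factors cost a maximum. This is why d - 1 is the exponent in the upper
  bounds.\<close>

lemma sum_Bernstein_power_le:
  assumes "0 \<le> x" "x \<le> 1" and B: "\<And>k. k \<le> n \<Longrightarrow> Bernstein n k x \<le> c"
  shows "(\<Sum>k\<le>n. Bernstein n k x ^ Suc e) \<le> c ^ e"
proof -
  have "(\<Sum>k\<le>n. Bernstein n k x ^ Suc e) \<le> (\<Sum>k\<le>n. Bernstein n k x * c ^ e)"
    using assms by (auto intro!: sum_mono mult_left_mono power_mono Bernstein_nonneg)
  then show ?thesis by (simp flip: sum_distrib_right)
qed

section \<open>The lower bound from the second moment\<close>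

lemma sum_Bernstein_variance:
  "(\<Sum>k\<le>n. (real k - real n * x)^2 * Bernstein n k x) = real n * (x * (1 - x))"
proof -
  have "(\<Sum>k\<le>n. (real k - real n * x)^2 * Bernstein n k x)
     = (\<Sum>k\<le>n. real k * (real k - 1) * Bernstein n k x + (1 - 2 * real n * x) * (real k * Bernstein n k x)
          + (real n * x)^2 * Bernstein n k x)"
    by (intro sum.cong refl) (simp add: power2_eq_square algebra_simps)
  also have "\<dots> = real n * (real n - 1) * x^2 + (1 - 2 * real n * x) * (real n * x) + (real n * x)^2"
    by (simp add: sum.distrib flip: sum_distrib_left)
  finally show ?thesis by (simp add: power2_eq_square algebra_simps)
qed

text \<open>Jensen's inequality for y^d by its tangent at the mean c, which is Bernoulli's
  inequality for y / c; summed over \<open>W\<close>, the linear terms cancel.\<close>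

lemma power_sum_ge:
  fixes b :: "'b \<Rightarrow> real"
  assumes "finite W" "W \<noteq> {}" "\<And>k. k \<in> W \<Longrightarrow> b k \<ge> 0" "d > 0"
  shows "real (card W) * (sum b W / card W) ^ d \<le> (\<Sum>k\<in>W. b k ^ d)"
proof (cases "sum b W > 0")
  case True
  define c where "c = sum b W / card W"
  have card: "real (card W) > 0" using assms by (simp add: card_gt_0_iff)
  have c: "c > 0" using True card by (simp add: c_def)
  have *: "c ^ d * (1 + real d * (b k / c - 1)) \<le> b k ^ d" if "k \<in> W" for k
  proof -
    have "1 + real d * (b k / c - 1) \<le> (1 + (b k / c - 1)) ^ d"
      using assms(3)[OF that] c by (intro Bernoulli_inequality) auto
    then have "c ^ d * (1 + real d * (b k / c - 1)) \<le> c ^ d * (b k / c) ^ d"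
      using c by (intro mult_left_mono) auto
    then show ?thesis using c by (simp add: power_divide)
  qed
  have "real (card W) * c ^ d = (\<Sum>k\<in>W. c ^ d * (1 + real d * (b k / c - 1)))"
  proof -
    have "(\<Sum>k\<in>W. c ^ d * (1 + real d * (b k / c - 1)))
      = c ^ d * (card W + real d * (sum b W / c - card W))"
      by (simp add: sum.distrib sum_subtractf flip: sum_distrib_left sum_divide_distrib)
    also have "sum b W / c = card W" using True card by (simp add: c_def)
    finally show ?thesis by simp
  qed
  also have "\<dots> \<le> (\<Sum>k\<in>W. b k ^ d)" using * by (rule sum_mono)
  finally show ?thesis by (simp add: c_def)
next
  case False
  then have "sum b W = 0" using sum_nonneg[of W b] assms by force
  then have "real (card W) * (sum b W / card W) ^ d = 0" using assms(4) by simp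
  also have "\<dots> \<le> (\<Sum>k\<in>W. b k ^ d)" using assms(3) by (intro sum_nonneg) simp
  finally show ?thesis .
qed

lemma card_nat_abs_diff_le:
  fixes c r :: real
  assumes "r \<ge> 0"
  shows "real (card {k::nat. k \<le> n \<and> \<bar>real k - c\<bar> \<le> r}) \<le> 2 * r + 1"
proof -
  have "int ` {k::nat. k \<le> n \<and> \<bar>real k - c\<bar> \<le> r} \<subseteq> {\<lceil>c - r\<rceil>..\<lfloor>c + r\<rfloor>}"
    by (auto simp: ceiling_le_iff le_floor_iff abs_le_iff)
  then have "card {k::nat. k \<le> n \<and> \<bar>real k - c\<bar> \<le> r} \<le> card {\<lceil>c - r\<rceil>..\<lfloor>c + r\<rfloor>}"
    by (metis card_image card_mono finite_atLeastAtMost_int inj_on_of_nat)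
  also have "\<dots> = nat (\<lfloor>c + r\<rfloor> - \<lceil>c - r\<rceil> + 1)" by simp
  finally have "real (card {k::nat. k \<le> n \<and> \<bar>real k - c\<bar> \<le> r}) \<le> real (nat (\<lfloor>c + r\<rfloor> - \<lceil>c - r\<rceil> + 1))"
    by simp
  also have "\<dots> \<le> 2 * r + 1"
  proof (cases "\<lfloor>c + r\<rfloor> - \<lceil>c - r\<rceil> + 1 \<ge> 0")
    case True
    have "of_int \<lfloor>c + r\<rfloor> \<le> c + r" "c - r \<le> of_int \<lceil>c - r\<rceil>" by auto
    moreover have "real (nat (\<lfloor>c + r\<rfloor> - \<lceil>c - r\<rceil> + 1)) = of_int \<lfloor>c + r\<rfloor> - of_int \<lceil>c - r\<rceil> + 1"
      using True by simp
    ultimately show ?thesis by linarith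
  qed (use assms in simp)
  finally show ?thesis .
qed

text \<open>By Chebyshev's inequality, half of the mass lies within \<open>sqrt 2\<close> standard deviations of the mean; the power mean inequality on this window gives the bound.\<close>

lemma sum_Bernstein_power_ge:
  assumes x: "0 < x" "x < 1" and v: "real n * (x * (1 - x)) \<ge> 1"
  shows "(1/2) ^ Suc e / (4 * sqrt (real n * (x * (1 - x)))) ^ e \<le> (\<Sum>k\<le>n. Bernstein n k x ^ Suc e)"
proof -
  define v where "v = real n * (x * (1 - x))"
  define W where "W = {k::nat. k \<le> n \<and> \<bar>real k - real n * x\<bar> \<le> sqrt (2 * v)}"
  let ?b = "\<lambda>k. Bernstein n k x"
  have v1: "v \<ge> 1" using v by (simp add: v_def)
  have finW: "finite W" and subW: "W \<subseteq> {..n}" by (auto simp: W_def)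
  have nn: "?b k \<ge> 0" for k using x by (auto intro: Bernstein_nonneg)
  have "2 * v * (\<Sum>k\<in>{..n}-W. ?b k) \<le> (\<Sum>k\<in>{..n}-W. (real k - real n * x)^2 * ?b k)"
    unfolding sum_distrib_left
  proof (intro sum_mono mult_right_mono nn)
    fix k assume "k \<in> {..n} - W"
    then have "sqrt (2 * v) \<le> \<bar>real k - real n * x\<bar>" by (auto simp: W_def)
    then have "sqrt (2 * v) ^ 2 \<le> \<bar>real k - real n * x\<bar> ^ 2" by (rule power_mono) (use v1 in auto)
    then show "2 * v \<le> (real k - real n * x)^2" using v1 by simp
  qed
  also have "\<dots> \<le> (\<Sum>k\<le>n. (real k - real n * x)^2 * ?b k)"
    by (intro sum_mono2) (auto simp: nn)
  also have "\<dots> = v" by (simp add: sum_Bernstein_variance v_def)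
  finally have "(\<Sum>k\<in>{..n}-W. ?b k) \<le> 1/2" using v1 by simp
  moreover have "(\<Sum>k\<in>{..n}-W. ?b k) + sum ?b W = 1"
    using sum.subset_diff[OF subW, of ?b] by simp
  ultimately have half: "1/2 \<le> sum ?b W" by linarith
  then have ne: "W \<noteq> {}" by auto
  define c where "c = real (card W)"
  have c: "c > 0" using ne finW by (simp add: c_def card_gt_0_iff)
  have "c \<le> 2 * sqrt (2 * v) + 1"
    unfolding c_def W_def by (rule card_nat_abs_diff_le) (use v1 in auto)
  \<comment> \<open>Three of the four units of \<open>sqrt v\<close> cover 2 sqrt (2 v), since sqrt
    2 \<le> 3/2; the fourth absorbs the extra lattice point, as \<open>v \<ge> 1\<close>.\<close>
  also have "\<dots> \<le> 4 * sqrt v"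
  proof -
    have "sqrt 2 \<le> 3/2" by (rule real_le_lsqrt) (auto simp: power2_eq_square)
    then have "sqrt 2 * sqrt v \<le> 3/2 * sqrt v" by (intro mult_right_mono) (use v1 in auto)
    moreover have "1 \<le> sqrt v" using v1 by simp
    moreover have "sqrt (2 * v) = sqrt 2 * sqrt v" by (rule real_sqrt_mult)
    ultimately show ?thesis by linarith
  qed
  finally have cle: "c \<le> 4 * sqrt v" .
  have "(1/2) ^ Suc e / (4 * sqrt v) ^ e \<le> (1/2) ^ Suc e / c ^ e"
    using cle c v1 by (intro divide_left_mono power_mono mult_pos_pos) auto
  also have "\<dots> = c * ((1/2) / c) ^ Suc e" using c by (simp add: field_simps)
  also have "\<dots> \<le> c * (sum ?b W / c) ^ Suc e"
    using half c by (intro mult_left_mono power_mono divide_right_mono) auto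
  also have "\<dots> \<le> (\<Sum>k\<in>W. ?b k ^ Suc e)"
    unfolding c_def using finW ne nn by (intro power_sum_ge) auto
  also have "\<dots> \<le> (\<Sum>k\<le>n. ?b k ^ Suc e)"
    using nn subW by (intro sum_mono2) auto
  finally show ?thesis by (simp add: v_def)
qed

section \<open>Bounds for the meeting probabilities\<close>

lemma inverse_sqrt_power_eq_powr:
  fixes n :: real
  shows "n > 0 \<Longrightarrow> (1 / sqrt n) ^ e = n powr (- real e / 2)"
proof -
  assume n: "n > 0"
  then have "1 / sqrt n = n powr (- (1/2))"
    by (simp add: powr_minus powr_half_sqrt inverse_eq_divide)
  then show ?thesis using n by (simp add: powr_power)
qed

lemma PP_pos: "\<forall>j\<in>{1..d}. 0 < p j \<and> p j < 1 \<Longrightarrow> PP d p > 0"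
  unfolding PP_def qq_def by (intro prod_pos) auto

lemma QQ_pos: "\<forall>j\<in>{1..d}. 0 < p j \<and> p j < 1 \<Longrightarrow> QQ d p > 0"
  unfolding QQ_def qq_def by (intro prod_pos) auto

text \<open>The choice of \<alpha> as d-th root of P makes every summand a perfect d-th power,
  because P^k = (\<alpha>^k)^d; the factor (1 + \<alpha>)^d in T normalises the powers to binomial
  weights.\<close>

lemma rr_eq_sum_Bernstein:
  fixes d p defines "\<alpha> \<equiv> root d (PP d p)"
  assumes d: "d > 0" and p: "\<forall>j\<in>{1..d}. 0 < p j \<and> p j < 1"
  shows "rr d p n = TT d p ^ n * (\<Sum>k\<le>n. Bernstein n k (\<alpha> / (1 + \<alpha>)) ^ d)"
proof -
  have P: "PP d p > 0" by (rule PP_pos) (rule p)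
  then have a: "\<alpha> > 0" and ad: "PP d p = \<alpha> ^ d" using d by (simp_all add: \<alpha>_def)
  have "TT d p ^ n * Bernstein n k (\<alpha> / (1 + \<alpha>)) ^ d = QQ d p ^ n * (real (n choose k) ^ d * PP d p ^ k)"
    if "k \<le> n" for k
  proof -
    have y: "1 - \<alpha> / (1 + \<alpha>) = 1 / (1 + \<alpha>)" using a by (simp add: field_simps)
    have z: "(1 + \<alpha>) ^ n = (1 + \<alpha>) ^ k * (1 + \<alpha>) ^ (n - k)"
      using that by (simp flip: power_add)
    have "Bernstein n k (\<alpha> / (1 + \<alpha>)) = real (n choose k) * \<alpha> ^ k / (1 + \<alpha>) ^ n"
      unfolding Bernstein_def y z by (simp add: power_divide)
    then have "TT d p ^ n * Bernstein n k (\<alpha> / (1 + \<alpha>)) ^ d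
       = QQ d p ^ n * ((1 + \<alpha>) ^ d) ^ n * (real (n choose k) ^ d * (\<alpha> ^ k) ^ d / ((1 + \<alpha>) ^ n) ^ d)"
      by (simp add: TT_def \<alpha>_def power_mult_distrib power_divide)
    also have "((1 + \<alpha>) ^ d) ^ n = ((1 + \<alpha>) ^ n) ^ d" by (metis mult.commute power_mult)
    also have "(\<alpha> ^ k) ^ d = PP d p ^ k" unfolding ad by (metis mult.commute power_mult)
    finally show ?thesis using a by simp
  qed
  then show ?thesis
    unfolding rr_def sum_distrib_left by (intro sum.cong) (auto simp: atLeast0AtMost)
qed

lemma TT_pos:
  assumes "\<forall>j\<in>{1..d}. 0 < p j \<and> p j < 1"
  shows "TT d p > 0"
proof -
  have "PP d p > 0" "QQ d p > 0" using assms by (blast intro: PP_pos QQ_pos)+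
  then show ?thesis unfolding TT_def
    by (intro mult_pos_pos zero_less_power add_pos_nonneg real_root_ge_zero) auto
qed

text \<open>With \<open>x = \<alpha> / (1 + \<alpha>)\<close>, both \<open>\<Prod>j y j\<close> and \<open>\<Prod>j z j\<close> below equal \<open>T\<close>, while \<open>(1 - x) * y j + x * z j = 1\<close>; hence concavity of \<open>ln\<close> bounds \<open>ln T\<close>.\<close>

lemma
  assumes d: "d > 0" and p: "\<forall>j\<in>{1..d}. 0 < p j \<and> p j < 1"
  shows TT_le_1: "TT d p \<le> 1"
    and TT_eq_1_imp_eq: "TT d p = 1 \<Longrightarrow> i \<in> {1..d} \<Longrightarrow> j \<in> {1..d} \<Longrightarrow> p i = p j"
proof -
  define \<alpha> where "\<alpha> = root d (PP d p)"
  have P: "PP d p > 0" by (rule PP_pos) (rule p)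
  then have a: "\<alpha> > 0" and ad: "PP d p = \<alpha> ^ d" using d by (simp_all add: \<alpha>_def)
  define y where "y j = qq p j * (1 + \<alpha>)" for j
  define z where "z j = p j * (1 + \<alpha>) / \<alpha>" for j
  have T: "TT d p > 0" by (rule TT_pos) (rule p)
  define x where "x = \<alpha> / (1 + \<alpha>)"
  have x: "0 < x" "x < 1" using a by (auto simp: x_def)
  have y: "y j > 0" and z: "z j > 0" if "j \<in> {1..d}" for j
    using bspec[OF p that] a by (auto simp: y_def z_def qq_def)
  have yT: "(\<Prod>j\<in>{1..d}. y j) = TT d p"
    by (simp add: y_def prod.distrib TT_def QQ_def \<alpha>_def)
  have zT: "(\<Prod>j\<in>{1..d}. z j) = TT d p"
  proof -
    have "z j = p j / qq p j * y j * (1 / \<alpha>)" if "j \<in> {1..d}" for j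
      using bspec[OF p that] a by (simp add: z_def y_def qq_def)
    then have "(\<Prod>j\<in>{1..d}. z j) = (\<Prod>j\<in>{1..d}. p j / qq p j * y j * (1 / \<alpha>))"
      by (rule prod.cong[OF refl])
    also have "\<dots> = PP d p * TT d p * (1 / \<alpha>) ^ d"
      by (simp only: prod.distrib yT PP_def) simp
    finally show ?thesis using a by (simp add: ad power_divide)
  qed
  have lny: "ln (TT d p) = (\<Sum>j\<in>{1..d}. ln (y j))"
    unfolding yT[symmetric] using y by (intro ln_prod) fastforce+
  have lnz: "ln (TT d p) = (\<Sum>j\<in>{1..d}. ln (z j))"
    unfolding zT[symmetric] using z by (intro ln_prod) fastforce+
  have "ln (TT d p) = (1 - x) * ln (TT d p) + x * ln (TT d p)" by (simp add: algebra_simps)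
  also have "\<dots> = (\<Sum>j\<in>{1..d}. (1 - x) * ln (y j) + x * ln (z j))"
    by (subst lny, subst lnz) (simp add: sum.distrib sum_distrib_left)
  finally have lnT: "ln (TT d p) = (\<Sum>j\<in>{1..d}. (1 - x) * ln (y j) + x * ln (z j))" .
  have yz: "(1 - x) * (y j - 1) + x * (z j - 1) = 0" if "j \<in> {1..d}" for j
  proof -
    have "(1 - x) * y j = qq p j" "x * z j = p j"
      using a by (simp_all add: x_def y_def z_def divide_simps)
    then show ?thesis by (simp add: algebra_simps qq_def)
  qed
  have term_le: "(1 - x) * ln (y j) + x * ln (z j) \<le> 0" if "j \<in> {1..d}" for j
  proof -
    have "(1 - x) * ln (y j) + x * ln (z j) \<le> (1 - x) * (y j - 1) + x * (z j - 1)"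
      using x y[OF that] z[OF that] by (intro add_mono mult_left_mono ln_le_minus_one) auto
    then show ?thesis using yz[OF that] by simp
  qed
  have "ln (TT d p) \<le> 0" unfolding lnT using term_le by (rule sum_nonpos)
  then show "TT d p \<le> 1" using T by simp
  \<comment> \<open>The equality case: nonpositive terms with sum 0 all vanish, which forces
    \<open>ln (y j) = y j - 1\<close> and so \<open>y j = 1\<close>. Every \<open>qq p j\<close> is
    then 1 / (1 + \<alpha>).\<close>
  have y1: "y j = 1" if "TT d p = 1" "j \<in> {1..d}" for j
  proof -
    have "(\<Sum>j\<in>{1..d}. - ((1 - x) * ln (y j) + x * ln (z j))) = 0"
      unfolding sum_negf lnT[symmetric] using \<open>TT d p = 1\<close> by simp
    then have "- ((1 - x) * ln (y j) + x * ln (z j)) = 0"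
      using sum_nonneg_eq_0_iff[of "{1..d}" "\<lambda>j. - ((1 - x) * ln (y j) + x * ln (z j))"] term_le that(2)
      by (simp only: finite_atLeastAtMost neg_0_le_iff_le)
    moreover have "x * ln (z j) \<le> x * (z j - 1)"
      using x z[OF that(2)] by (intro mult_left_mono ln_le_minus_one) auto
    ultimately have "(1 - x) * (y j - 1) \<le> (1 - x) * ln (y j)" using yz[OF that(2)] by linarith
    then have "y j - 1 \<le> ln (y j)" using x by simp
    then show ?thesis using ln_le_minus_one[OF y[OF that(2)]] y[OF that(2)] by (intro ln_eq_minus_one) auto
  qed
  show "p i = p j" if "TT d p = 1" "i \<in> {1..d}" "j \<in> {1..d}"
  proof -
    have "y i = y j" using y1 that by simp
    then show ?thesis using a by (simp add: y_def qq_def)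
  qed
qed

text \<open>The factor (\<alpha> + 1) / sqrt \<alpha> in \<open>MM\<close> is the reciprocal of the
  standard deviation of a single trial, as x (1 - x) = \<alpha> / (1 + \<alpha>)^2.\<close>

lemma MM_eq:
  assumes "\<alpha> > 0" "l < 1" "n > 0"
  shows "1 / ((1 - l) * sqrt (2 * pi * (n * (\<alpha> / (1 + \<alpha>) * (1 - \<alpha> / (1 + \<alpha>))))))
      = MM \<alpha> l / sqrt (2 * pi) * (1 / sqrt n)"
proof -
  have "\<alpha> / (1 + \<alpha>) * (1 - \<alpha> / (1 + \<alpha>)) = \<alpha> / (1 + \<alpha>)^2"
    using assms by (simp add: field_simps power2_eq_square)
  then have E: "sqrt (2 * pi * (n * (\<alpha> / (1 + \<alpha>) * (1 - \<alpha> / (1 + \<alpha>)))))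
     = sqrt (2 * pi) * (sqrt n * (sqrt \<alpha> / (1 + \<alpha>)))"
    using assms by (simp add: real_sqrt_mult real_sqrt_divide)
  show ?thesis unfolding E MM_def using assms by (simp add: divide_simps)
qed

text \<open>\<open>NN\<close> is the threshold demanded by \<open>Bernstein_le_max\<close>: n > 1 /
  (l \<alpha>) is 1 - x < l n x, and n > \<alpha> / l is x < l n (1 - x).\<close>

lemma rr_upper:
  fixes d p defines "\<alpha> \<equiv> root d (PP d p)"
  assumes d: "d > 0" and p: "\<forall>j\<in>{1..d}. 0 < p j \<and> p j < 1"
    and l: "0 < l" "l < 1" and n: "n \<ge> NN \<alpha> l"
  shows "rr d p n \<le> (MM \<alpha> l / sqrt (2 * pi)) ^ (d - 1) * (real n powr (- (real d - 1) / 2) * TT d p ^ n)"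
proof -
  obtain e where e: "d = Suc e" using d by (cases d) auto
  have "PP d p > 0" by (rule PP_pos) (rule p)
  then have a: "\<alpha> > 0" using d by (simp add: \<alpha>_def)
  have T: "TT d p > 0" by (rule TT_pos) (rule p)
  define x where "x = \<alpha> / (1 + \<alpha>)"
  have x: "0 < x" "x < 1" using a by (auto simp: x_def)
  have floor: "y < real n" if "nat \<lfloor>y\<rfloor> + 1 \<le> n" for y :: real using that by linarith
  have "\<alpha> / l < real n" "1 / (l * \<alpha>) < real n"
    using n by (auto simp: NN_def intro!: floor)
  then have "1 / (1 + \<alpha>) < real n * l * \<alpha> / (1 + \<alpha>)" "\<alpha> / (1 + \<alpha>) < real n * l / (1 + \<alpha>)"
    using a l by (auto intro!: divide_strict_right_mono simp: pos_divide_less_eq mult_ac)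
  moreover have "1 - x = 1 / (1 + \<alpha>)" using a by (simp add: x_def field_simps)
  ultimately have n1: "1 - x < l * (real n * x)" and n2: "x < l * (real n * (1 - x))"
    by (simp_all add: x_def mult_ac)
  have npos: "n > 0" using n by (auto simp: NN_def)
  define c where "c = MM \<alpha> l / sqrt (2 * pi) * (1 / sqrt (real n))"
  have B: "Bernstein n k x \<le> c" if "k \<le> n" for k
    using Bernstein_le_max[OF x l n1 n2 that] MM_eq[OF a l(2), of "real n"] npos by (simp add: c_def x_def)
  have "rr d p n = TT d p ^ n * (\<Sum>k\<le>n. Bernstein n k x ^ d)"
    unfolding x_def \<alpha>_def using d p by (rule rr_eq_sum_Bernstein)
  also have "\<dots> \<le> TT d p ^ n * c ^ e"
    unfolding e using x B T e
    by (intro mult_left_mono sum_Bernstein_power_le) (auto intro: less_imp_le)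
  also have "c ^ e = (MM \<alpha> l / sqrt (2 * pi)) ^ (d - 1) * real n powr (- (real d - 1) / 2)"
    unfolding c_def power_mult_distrib using npos e by (simp add: inverse_sqrt_power_eq_powr)
  finally show ?thesis by (simp add: mult_ac)
qed

text \<open>Here u is the reciprocal of x (1 - x), so it is unchanged under \<alpha> -> 1 / \<alpha>
  and serves both \<open>C1\<close> and \<open>C2\<close>. In each constant the maximum is at most u
  and the exponent at most -u/2, since \<open>l\<close> only enlarges the denominators of the former
  and the modulus of the latter. Writing u as a product lets the exponents be compared factor by
  factor.\<close>

lemma KK_le:
  fixes \<alpha> l defines "u \<equiv> 1 / \<alpha> * (\<alpha> + 1)^2"
  assumes a: "\<alpha> > 0" and l: "0 < l" "l < 1"
  shows "KK \<alpha> d l \<le> 2 * (u * exp (- u / 2)) ^ d"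
proof -
  have "0 \<le> (\<alpha> - 1)^2" by simp
  then have u4: "4 \<le> u" using a by (simp add: u_def field_simps power2_eq_square)
  have la: "1 + l * \<alpha> > 0" using a l by (simp add: add_pos_pos)
  have half: "- (1/2) * b \<le> - c / 2" if "c \<le> b" for b c :: real
    using that by linarith
  have C1: "C1 \<alpha> l \<le> u * exp (- u / 2)"
    unfolding C1_def
  proof (intro mult_mono)
    have "(\<alpha> + 1)^2 / (\<alpha> * (1 + l * \<alpha>)) \<le> (\<alpha> + 1)^2 / \<alpha>"
      using a l la by (intro divide_left_mono mult_pos_pos) auto
    then show "max 4 ((\<alpha> + 1)\<^sup>2 / (\<alpha> * (1 + l * \<alpha>))) \<le> u" using u4 by (simp add: u_def)
    have "1 / \<alpha> = (1 - l) / ((1 - l) * \<alpha>)" using l by simp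
    also have "\<dots> \<le> (1 + l * \<alpha>) / ((1 - l) * \<alpha>)"
    proof (rule divide_right_mono)
      show "1 - l \<le> 1 + l * \<alpha>" using mult_pos_pos[OF l(1) a] l by linarith
    qed (use a l in simp)
    finally have "1 / \<alpha> \<le> (1 + l * \<alpha>) / ((1 - l) * \<alpha>)" .
    then have "1 / \<alpha> * (\<alpha> + 1)^2 \<le> (1 + l * \<alpha>) / ((1 - l) * \<alpha>) * ((\<alpha> + 1)\<^sup>2 + l * \<alpha> / (1 + l * \<alpha>))"
      using a l by (intro mult_mono) auto
    then show "exp (- (1 / 2) * ((1 + l * \<alpha>) / ((1 - l) * \<alpha>)) * ((\<alpha> + 1)\<^sup>2 + l * \<alpha> / (1 + l * \<alpha>))) \<le> exp (- u / 2)"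
      unfolding exp_le_cancel_iff u_def mult.assoc by (simp only: half)
  qed (use u4 in auto)
  have C2: "C2 \<alpha> l \<le> u * exp (- u / 2)"
    unfolding C2_def
  proof (intro mult_mono)
    have "(\<alpha> + 1)^2 / (\<alpha> + l) \<le> (\<alpha> + 1)^2 / \<alpha>"
      using a l by (intro divide_left_mono) auto
    then show "max 4 ((\<alpha> + 1)\<^sup>2 / (\<alpha> + l)) \<le> u" using u4 by (simp add: u_def)
    have "1 / \<alpha> = ((1 - l) * \<alpha>) / ((1 - l) * \<alpha>\<^sup>2)" using l a by (simp add: power2_eq_square)
    also have "\<dots> \<le> (\<alpha> + l) / ((1 - l) * \<alpha>\<^sup>2)"
      using a l by (intro divide_right_mono) (auto simp: algebra_simps intro: add_nonneg_nonneg)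
    finally have "1 / \<alpha> \<le> (\<alpha> + l) / ((1 - l) * \<alpha>\<^sup>2)" .
    then have "1 / \<alpha> * (\<alpha> + 1)^2 \<le> (\<alpha> + l) / ((1 - l) * \<alpha>\<^sup>2) * ((\<alpha> + 1)\<^sup>2 + l * \<alpha>\<^sup>2 / (\<alpha> + l))"
      using a l by (intro mult_mono) auto
    then show "exp (- (1 / 2) * ((\<alpha> + l) / ((1 - l) * \<alpha>\<^sup>2)) * ((\<alpha> + 1)\<^sup>2 + l * \<alpha>\<^sup>2 / (\<alpha> + l))) \<le> exp (- u / 2)"
      unfolding exp_le_cancel_iff u_def mult.assoc by (simp only: half)
  qed (use u4 in auto)
  have nn: "0 \<le> C1 \<alpha> l" "0 \<le> C2 \<alpha> l" by (simp_all add: C1_def C2_def)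
  have "((1 - l) * \<alpha> + 1) / (\<alpha> + 1) * C1 \<alpha> l ^ d \<le> 1 * (u * exp (- u / 2)) ^ d"
    using a l C1 nn by (intro mult_mono power_mono) (auto simp: algebra_simps)
  moreover have "C2 \<alpha> l ^ d \<le> (u * exp (- u / 2)) ^ d"
    using C2 nn by (intro power_mono)
  ultimately show ?thesis by (simp add: KK_def)
qed

lemma KK_pos:
  assumes "\<alpha> > 0" "0 < l" "l < 1"
  shows "KK \<alpha> d l > 0"
  unfolding KK_def C1_def C2_def using assms
  by (intro add_pos_pos mult_pos_pos zero_less_power divide_pos_pos) auto

text \<open>For u \<ge> 4 the function u exp (-u/2) is largest at u = 4, with value 4 / e^2. What
  remains is the numerical fact 16 sqrt (2 pi) \<le> e^4.\<close>

lemma sqrt_2pi_exp_bound: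
  fixes u :: real
  assumes "u \<ge> 4"
  shows "sqrt (2 * pi) / exp 2 * (u * exp (- u / 2)) \<le> 1 / 4"
proof -
  have "u / 4 \<le> 1 + (u / 2 - 2)" using assms by simp
  also have "\<dots> \<le> exp (u / 2 - 2)" by (rule exp_ge_add_one_self)
  finally have "u * exp (- u / 2) \<le> 4 * exp (u / 2 - 2) * exp (- u / 2)"
    by (intro mult_right_mono) auto
  also have "\<dots> = 4 / exp 2" by (simp add: mult.assoc exp_minus field_simps flip: exp_add)
  finally have 1: "u * exp (- u / 2) \<le> 4 / exp 2" .
  have "2 * pi \<le> (13/5)^2" using pi_approx by (simp add: power2_eq_square)
  then have 2: "sqrt (2 * pi) \<le> 13/5" by (intro real_le_lsqrt) auto
  \<comment> \<open>208/5 is 16 times the bound 13/5 for sqrt (2 pi). The power 1.1^40 is about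
    45.3, close enough to e^4 to exceed it.\<close>
  have "208 / 5 \<le> (1 + 4 / real 40) ^ 40" by (simp add: power_divide)
  also have "\<dots> \<le> exp 4" by (rule exp_ge_one_plus_x_over_n_power_n) auto
  finally have 3: "208 / 5 \<le> exp (4::real)" .
  have "sqrt (2 * pi) / exp 2 * (u * exp (- u / 2)) \<le> (13/5) / exp 2 * (4 / exp 2)"
    using 1 2 assms by (intro mult_mono divide_right_mono) auto
  also have "\<dots> = (52/5) / exp 4" by (simp flip: exp_add)
  also have "\<dots> \<le> 1 / 4" using 3 by (simp add: field_simps)
  finally show ?thesis .
qed

text \<open>\<open>LL\<close> enters through n \<ge> u, which says that the variance n / u is at
  least 1, as the Chebyshev bound requires. The stated constant and the Chebyshev constant are then
  separated by 2 (1/4)^d.\<close>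

lemma rr_lower:
  fixes d p defines "\<alpha> \<equiv> root d (PP d p)"
  assumes d: "d > 0" and p: "\<forall>j\<in>{1..d}. 0 < p j \<and> p j < 1"
    and l: "0 < l" "l < 1" and n: "n \<ge> LL \<alpha> l"
  shows "(sqrt (2 * pi) / exp 2) ^ d * KK \<alpha> d l * (real n powr (- (real d - 1) / 2) * TT d p ^ n) \<le> rr d p n"
proof -
  obtain e where e: "d = Suc e" using d by (cases d) auto
  have "PP d p > 0" by (rule PP_pos) (rule p)
  then have a: "\<alpha> > 0" using d by (simp add: \<alpha>_def)
  have T: "TT d p > 0" by (rule TT_pos) (rule p)
  define x where "x = \<alpha> / (1 + \<alpha>)"
  define u where "u = (\<alpha> + 1)^2 / \<alpha>"
  \<comment> \<open>s / (2 l) is the positive root of l y^2 - (\<alpha> + 1) y - \<alpha>, and s /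
    (2 l \<alpha>) that of l \<alpha> y^2 - (\<alpha> + 1) y - 1.\<close>
  define s where "s = (\<alpha> + 1) + sqrt ((\<alpha> + 1)^2 + 4 * l * \<alpha>)"
  have "0 \<le> (\<alpha> - 1)^2" by simp
  then have u4: "4 \<le> u" using a by (simp add: u_def field_simps power2_eq_square)
  have x: "0 < x" "x < 1" using a by (auto simp: x_def)
  have floor: "y < real n" if "nat \<lfloor>y\<rfloor> + 1 \<le> n" for y :: real using that by linarith
  have s1: "(s / (2 * l * \<alpha>))^2 < real n" and s2: "(s / (2 * l))^2 < real n"
    using n by (auto simp: LL_def s_def intro!: floor)
  have "sqrt ((\<alpha> + 1)^2) \<le> sqrt ((\<alpha> + 1)^2 + 4 * l * \<alpha>)"
    using a l by (intro real_sqrt_le_mono) auto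
  then have s: "2 * (\<alpha> + 1) \<le> s" using a by (simp add: s_def)
  have "2 * (\<alpha> + 1) * l \<le> 2 * (\<alpha> + 1) * 1" using a l by (intro mult_left_mono) auto
  then have sl: "\<alpha> + 1 \<le> s / (2 * l)" using s a l by (simp add: field_simps)
  have npos: "n > 0" using n by (auto simp: LL_def)
  have "(\<alpha> + 1)^2 \<le> (s / (2 * l))^2" using sl a by (intro power_mono) auto
  then have n1: "(\<alpha> + 1)^2 \<le> real n" using s2 by linarith
  have "((\<alpha> + 1) / \<alpha>)^2 \<le> (s / (2 * l) / \<alpha>)^2" using sl a by (intro power_mono divide_right_mono) auto
  then have n2: "((\<alpha> + 1) / \<alpha>)^2 \<le> real n" using s1 by (simp add: mult.assoc)
  \<comment> \<open>u is the geometric mean of (\<alpha> + 1)^2 and ((\<alpha> + 1) / \<alpha>)^2,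
    so the larger of the two dominates it; which one depends on the side of 1 on which \<alpha>
    lies.\<close>
  have un: "u \<le> real n"
  proof (cases "\<alpha> \<ge> 1")
    case True
    then have "u \<le> (\<alpha> + 1)^2" using a by (simp add: u_def field_simps)
    then show ?thesis using n1 by linarith
  next
    case False
    have "u = \<alpha> * ((\<alpha> + 1) / \<alpha>)^2" using a by (simp add: u_def field_simps power2_eq_square)
    also have "\<dots> \<le> 1 * ((\<alpha> + 1) / \<alpha>)^2" using False by (intro mult_right_mono) auto
    finally show ?thesis using n2 by linarith
  qed
  have xu: "x * (1 - x) = 1 / u"
    using a by (simp add: x_def u_def field_simps power2_eq_square)
  have v: "real n * (x * (1 - x)) \<ge> 1" using un u4 by (simp add: xu field_simps)
  define R where "R = real n powr (- (real d - 1) / 2)"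
  have R: "R = (1 / sqrt (real n)) ^ e" using npos e by (simp add: R_def inverse_sqrt_power_eq_powr)
  have Rnn: "R \<ge> 0" by (simp add: R_def)
  define h where "h = sqrt (2 * pi) / exp 2 * (u * exp (- u / 2))"
  have h: "0 \<le> h" "h \<le> 1/4" using sqrt_2pi_exp_bound[OF u4] u4 by (auto simp: h_def)
  have "(sqrt (2 * pi) / exp 2) ^ d * KK \<alpha> d l \<le> (sqrt (2 * pi) / exp 2) ^ d * (2 * (u * exp (- u / 2)) ^ d)"
    using KK_le[OF a l, of d, simplified] by (intro mult_left_mono) (auto simp: u_def)
  also have "\<dots> = 2 * h ^ d" unfolding h_def by (simp only: power_mult_distrib mult_ac)
  also have "\<dots> \<le> 2 * (1/4) ^ d" using h by (intro mult_left_mono power_mono) auto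
  \<comment> \<open>With d = e + 1 this is an exact identity; the free factor 2^e is what sqrt u
    \<ge> 2 supplies next.\<close>
  also have "\<dots> = (1/2) ^ d / 4 ^ e * 2 ^ e"
    by (simp add: e power_divide flip: power_mult_distrib)
  also have "\<dots> \<le> (1/2) ^ d / 4 ^ e * sqrt u ^ e"
    using u4 by (intro mult_left_mono power_mono real_le_rsqrt) auto
  finally have "(sqrt (2 * pi) / exp 2) ^ d * KK \<alpha> d l * R \<le> (1/2) ^ d / 4 ^ e * sqrt u ^ e * R"
    using Rnn by (rule mult_right_mono)
  also have "\<dots> = (1/2) ^ Suc e / (4 * sqrt (real n * (x * (1 - x)))) ^ e"
    using u4 by (simp add: xu R e real_sqrt_divide power_divide power_mult_distrib)
  also have "\<dots> \<le> (\<Sum>k\<le>n. Bernstein n k x ^ d)"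
    unfolding e using x v by (rule sum_Bernstein_power_ge)
  finally have "(sqrt (2 * pi) / exp 2) ^ d * KK \<alpha> d l * R * TT d p ^ n
      \<le> (\<Sum>k\<le>n. Bernstein n k x ^ d) * TT d p ^ n"
    using T by (intro mult_right_mono) auto
  also have "\<dots> = rr d p n"
    using rr_eq_sum_Bernstein[OF d p] by (simp add: x_def \<alpha>_def mult.commute)
  finally show ?thesis by (simp add: R_def mult_ac)
qed

section \<open>Renewal sequences and boundary values of series\<close>

lemma convolution_sums:
  fixes a b :: "nat \<Rightarrow> real"
  assumes "summable a" "summable b" "\<And>n. a n \<ge> 0" "\<And>n. b n \<ge> 0"
  shows "(\<lambda>n. \<Sum>i\<le>n. a i * b (n - i)) sums (suminf a * suminf b)"
  using assms by (intro Cauchy_product_sums) (simp_all add: real_norm_def)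

text \<open>The last term of the convolution is \<open>f n * r 0\<close>. The inequality transfers
  summability of the moment series from \<open>r\<close> to \<open>f\<close>.\<close>

lemma renewal_le:
  fixes r f :: "nat \<Rightarrow> real"
  assumes "\<And>n. f n \<ge> 0" "\<And>n. r n \<ge> 0" "r 0 = 1"
    and "\<And>n. n > 0 \<Longrightarrow> r n = (\<Sum>i\<le>n. f i * r (n - i))"
    and "f 0 = 0"
  shows "f n \<le> r n"
proof (cases "n = 0")
  case False
  have "f n * r (n - n) \<le> (\<Sum>i\<le>n. f i * r (n - i))"
    using assms(1,2) by (intro member_le_sum) auto
  then show ?thesis using assms False by simp
qed (use assms in simp)

text \<open>The Euler operator \<open>x d/dx\<close> acts on coefficients as multiplication by \<open>n\<close> and is a derivation for convolution. Applying it once and twice to \<open>R = 1 + F R\<close> and evaluating at \<open>x = 1\<close> gives the three identities.\<close>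

lemma renewal_moments:
  fixes r f :: "nat \<Rightarrow> real"
  assumes f: "\<And>n. f n \<ge> 0" and r: "\<And>n. r n \<ge> 0" and r0: "r 0 = 1" and f0: "f 0 = 0"
    and ren: "\<And>n. n > 0 \<Longrightarrow> r n = (\<Sum>i\<le>n. f i * r (n - i))"
    and sm: "summable (\<lambda>n. real n ^ 2 * r n)"
    and pos: "(\<Sum>n. real n * f n) > 0"
  shows "(\<Sum>n. real n ^ 2 * f n) / (\<Sum>n. real n * f n)
       = (\<Sum>n. real n ^ 2 * r n) / (\<Sum>n. real n * r n) - 2 * (\<Sum>n. real n * r n) / (\<Sum>n. r n)"
proof -
  have sq: "real n \<le> real n ^ 2" for n
    using of_nat_mono[where 'a = real, OF power2_nat_le_imp_le[OF order_refl[of "n ^ 2"]]] by simp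
  have sr1: "summable (\<lambda>n. real n * r n)"
    by (rule summable_comparison_test_ev[OF _ sm])
       (use r sq in \<open>auto intro!: always_eventually mult_right_mono simp: abs_mult\<close>)
  have sr0: "summable r"
  proof (rule summable_comparison_test_ev[OF _ sr1])
    have "r n \<le> real n * r n" if "n > 0" for n
      using mult_right_mono[of 1 "real n" "r n"] r that by simp
    then show "\<forall>\<^sub>F n in sequentially. norm (r n) \<le> real n * r n"
      using r by (intro eventually_mono[OF eventually_gt_at_top[of 0]]) simp
  qed
  have fr: "f n \<le> r n" for n using renewal_le[of f r n] f r r0 ren f0 by blast
  have sf2: "summable (\<lambda>n. real n ^ 2 * f n)"
    by (rule summable_comparison_test_ev[OF _ sm]) (use f fr in \<open>auto intro!: always_eventually mult_left_mono\<close>)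
  have sf1: "summable (\<lambda>n. real n * f n)"
    by (rule summable_comparison_test_ev[OF _ sr1]) (use f fr in \<open>auto intro!: always_eventually mult_left_mono\<close>)
  have sf0: "summable f"
    by (rule summable_comparison_test_ev[OF _ sr0]) (use f fr in \<open>auto intro!: always_eventually\<close>)
  define R DR DDR F DF DDF where "R = (\<Sum>n. r n)" "DR = (\<Sum>n. real n * r n)" "DDR = (\<Sum>n. real n ^ 2 * r n)"
    "F = (\<Sum>n. f n)" "DF = (\<Sum>n. real n * f n)" "DDF = (\<Sum>n. real n ^ 2 * f n)"
  note defs = this
  have c0: "(\<lambda>n. \<Sum>i\<le>n. f i * r (n - i)) sums (F * R)"
    unfolding defs by (rule convolution_sums) (use sf0 sr0 f r in auto)
  have c1: "(\<lambda>n. \<Sum>i\<le>n. (real i * f i) * r (n - i)) sums (DF * R)"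
    unfolding defs by (rule convolution_sums) (use sf1 sr0 f r in auto)
  have c2: "(\<lambda>n. \<Sum>i\<le>n. f i * (real (n - i) * r (n - i))) sums (F * DR)"
    unfolding defs by (rule convolution_sums[of _ "\<lambda>n. real n * r n"]) (use sf0 sr1 f r in auto)
  have c3: "(\<lambda>n. \<Sum>i\<le>n. (real i ^ 2 * f i) * r (n - i)) sums (DDF * R)"
    unfolding defs by (rule convolution_sums) (use sf2 sr0 f r in auto)
  have c4: "(\<lambda>n. \<Sum>i\<le>n. (real i * f i) * (real (n - i) * r (n - i))) sums (DF * DR)"
    unfolding defs by (rule convolution_sums[of _ "\<lambda>n. real n * r n"]) (use sf1 sr1 f r in auto)
  have c5: "(\<lambda>n. \<Sum>i\<le>n. f i * (real (n - i) ^ 2 * r (n - i))) sums (F * DDR)"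
    unfolding defs by (rule convolution_sums[of _ "\<lambda>n. real n ^ 2 * r n"]) (use sf0 sm f r in auto)
  have "R = 1 + F * R"
  proof -
    have "r n = (if n = 0 then 1 else 0) + (\<Sum>i\<le>n. f i * r (n - i))" for n
      using ren[of n] r0 f0 by (cases n) auto
    then have "r = (\<lambda>n. (if n = 0 then 1 else 0) + (\<Sum>i\<le>n. f i * r (n - i)))" by (rule ext)
    moreover have "(\<lambda>n. (if n = 0 then 1 else 0) + (\<Sum>i\<le>n. f i * r (n - i))) sums (1 + F * R)"
      by (intro sums_add c0) (rule sums_single)
    ultimately show ?thesis unfolding defs(1) by (metis sums_unique)
  qed
  moreover have "DR = DF * R + F * DR"
  proof -
    have "real n * r n = (\<Sum>i\<le>n. (real i * f i) * r (n - i)) + (\<Sum>i\<le>n. f i * (real (n - i) * r (n - i)))" for n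
    proof (cases "n = 0")
      case False
      then have "real n * r n = (\<Sum>i\<le>n. real n * (f i * r (n - i)))"
        using ren[of n] by (simp add: sum_distrib_left)
      also have "\<dots> = (\<Sum>i\<le>n. (real i * f i) * r (n - i) + f i * (real (n - i) * r (n - i)))"
        by (intro sum.cong refl) (simp add: of_nat_diff algebra_simps)
      finally show ?thesis by (simp add: sum.distrib)
    qed simp
    then have "(\<lambda>n. real n * r n) sums (DF * R + F * DR)"
      using sums_add[OF c1 c2] by simp
    then show ?thesis unfolding defs(2) by (metis sums_unique)
  qed
  moreover have "DDR = DDF * R + 2 * (DF * DR) + F * DDR"
  proof -
    have "real n ^ 2 * r n = (\<Sum>i\<le>n. (real i ^ 2 * f i) * r (n - i))
        + 2 * (\<Sum>i\<le>n. (real i * f i) * (real (n - i) * r (n - i)))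
        + (\<Sum>i\<le>n. f i * (real (n - i) ^ 2 * r (n - i)))" for n
    proof (cases "n = 0")
      case False
      then have "real n ^ 2 * r n = (\<Sum>i\<le>n. real n ^ 2 * (f i * r (n - i)))"
        using ren[of n] by (simp add: sum_distrib_left)
      also have "\<dots> = (\<Sum>i\<le>n. (real i ^ 2 * f i) * r (n - i)
          + 2 * ((real i * f i) * (real (n - i) * r (n - i))) + f i * (real (n - i) ^ 2 * r (n - i)))"
        by (intro sum.cong refl) (simp add: of_nat_diff power2_eq_square algebra_simps)
      finally show ?thesis by (simp add: sum.distrib sum_distrib_left)
    qed simp
    then have "(\<lambda>n. real n ^ 2 * r n) sums (DDF * R + 2 * (DF * DR) + F * DDR)"
      using sums_add[OF sums_add[OF c3 sums_mult[OF c4, of 2]] c5] by simp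
    then show ?thesis unfolding defs(3) by (metis sums_unique)
  qed
  moreover have "R \<ge> 1"
    using sum_le_suminf[OF sr0, of "{0}"] r r0 unfolding defs by simp
  moreover have "DF > 0" using pos unfolding defs .
  ultimately have "DDF / DF = DDR / DR - 2 * DR / R"
  proof -
    assume R: "R = 1 + F * R" and D: "DR = DF * R + F * DR" and DD: "DDR = DDF * R + 2 * (DF * DR) + F * DDR"
      and R1: "R \<ge> 1" and DF: "DF > 0"
    \<comment> \<open>R = 1 + F R makes h the reciprocal of R. In terms of h the other two
      identities can be solved for DR and DDF.\<close>
    define h where "h = 1 - F"
    have h: "h * R = 1" using R by (simp add: h_def algebra_simps)
    then have h0: "h \<noteq> 0" by auto
    with h have Rh: "R = 1 / h" by (simp add: field_simps)
    have "DR * h = DF * R" "DDR * h = DDF * R + 2 * (DF * DR)"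
      using D DD by (simp_all add: h_def algebra_simps)
    then have D': "DR = DF / h^2" and DD': "DDF = (DDR * h - 2 * DF * DR) * h"
      using h0 unfolding Rh by (simp_all add: field_simps power2_eq_square)
    show ?thesis unfolding DD' D' Rh using h0 DF by (simp add: divide_simps power2_eq_square)
  qed
  then show ?thesis unfolding defs .
qed

text \<open>The range c \<le> 1 covers the largest exponent in use, -(d - 5) / 2 with d \<ge> 3;
  there the differentiated geometric series is a majorant.\<close>

lemma summable_powr_mult_power:
  fixes c y :: real
  assumes "c \<le> 1" "0 \<le> y" "y < 1"
  shows "summable (\<lambda>n. real n powr c * y ^ n)"
proof (rule summable_comparison_test_ev)
  have "summable (\<lambda>n. of_nat (Suc n) * y ^ n)"
    using geometric_deriv_sums[of y] assms by (auto simp: sums_iff)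
  then show "summable (\<lambda>n. real (Suc n) * y ^ n)" by simp
  show "\<forall>\<^sub>F n in sequentially. norm (real n powr c * y ^ n) \<le> real (Suc n) * y ^ n"
    using eventually_ge_at_top[of 1]
  proof eventually_elim
    case (elim n)
    have "real n powr c \<le> real n powr 1" using elim assms by (intro powr_mono) auto
    then have "real n powr c * y ^ n \<le> real (Suc n) * y ^ n" using assms by (intro mult_right_mono) auto
    then show ?case using assms by simp
  qed
qed

lemma summable_powr_mult_power_shift:
  assumes "summable (\<lambda>n. real n powr c * y ^ n)"
  shows "summable (\<lambda>m. real (m + N) powr c * y ^ (m + N))"
  using summable_ignore_initial_segment[OF assms] .

text \<open>Dominated convergence for series: near 1 one has |h x| < 2 and x^(m + N) \<le> 1, so
  twice the series at x = 1 is a majorant. The factor \<open>h\<close> covers both the plain tail (h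
  = 1) and those carrying \<open>inverse x\<close>.\<close>

lemma tail_series_tendsto:
  fixes T c :: real and h :: "real \<Rightarrow> real"
  assumes T: "0 < T" and sm: "summable (\<lambda>n. real n powr c * T ^ n)" and h: "(h \<longlongrightarrow> 1) (at_left 1)"
  shows "((\<lambda>x. \<Sum>m. real (m + N) powr c * h x * (T * x) ^ (m + N)) \<longlongrightarrow> (\<Sum>m. real (m + N) powr c * T ^ (m + N))) (at_left 1)"
proof -
  let ?a = "\<lambda>m x. real (m + N) powr c * h x * (T * x) ^ (m + N)"
  have lim: "((\<lambda>x. ?a m x) \<longlongrightarrow> real (m + N) powr c * 1 * (T * 1) ^ (m + N)) (at_left 1)" for m
    by (intro tendsto_intros h)
  have "\<forall>\<^sub>F x in at_left 1. \<bar>h x\<bar> < 2"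
    using order_tendstoD(2)[OF tendsto_rabs[OF h], of 2] by simp
  moreover have "\<forall>\<^sub>F x in at_left (1::real). x \<in> {0<..<1}" by (rule eventually_at_leftI[of 0]) auto
  ultimately have "\<forall>\<^sub>F x in at_left 1. \<forall>m. norm (?a m x) \<le> 2 * (real (m + N) powr c * T ^ (m + N))"
  proof eventually_elim
    case (elim x)
    show ?case
    proof
      fix m
      have "norm (?a m x) = real (m + N) powr c * T ^ (m + N) * (\<bar>h x\<bar> * x ^ (m + N))"
        using elim T by (simp add: abs_mult power_mult_distrib power_abs)
      also have "\<dots> \<le> real (m + N) powr c * T ^ (m + N) * (2 * 1)"
        using elim T by (intro mult_left_mono mult_mono power_le_one) auto
      finally show "norm (?a m x) \<le> 2 * (real (m + N) powr c * T ^ (m + N))" by simp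
    qed
  qed
  with eventually_True[of at_top]
  have "\<forall>\<^sub>F p in at_top \<times>\<^sub>F at_left 1. True \<and>
      (\<forall>m. norm (?a m (snd p)) \<le> 2 * (real (m + N) powr c * T ^ (m + N)))"
    by (rule eventually_prodI)
  then have "\<forall>\<^sub>F (m, x) in at_top \<times>\<^sub>F at_left 1. norm (?a m x) \<le> 2 * (real (m + N) powr c * T ^ (m + N))"
    by (rule eventually_mono) (simp add: case_prod_beta)
  from tannerys_theorem[OF lim this summable_mult[OF summable_powr_mult_power_shift[OF sm]]]
  show ?thesis by simp
qed

text \<open>At x = 1 the partial sums of the nonnegative terms are unbounded. One that exceeds Z
  still does so for x near 1, by continuity, and the whole series is at least as large.\<close>

lemma tail_series_at_top:
  fixes T c :: real
  assumes T: "0 < T" "T \<le> 1" and c: "c \<le> 1" and sm: "\<not> summable (\<lambda>n. real n powr c * T ^ n)"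
  shows "filterlim (\<lambda>x. \<Sum>m. real (m + N) powr c * inverse x * (T * x) ^ (m + N)) at_top (at_left 1)"
  unfolding filterlim_at_top
proof
  fix Z :: real
  let ?a = "\<lambda>m x. real (m + N) powr c * inverse x * (T * x) ^ (m + N)"
  have ns: "\<not> summable (\<lambda>m. real (m + N) powr c * T ^ (m + N))"
    using sm summable_iff_shift[of "\<lambda>n. real n powr c * T ^ n" N] by simp
  obtain n where n: "(\<Sum>m<n. real (m + N) powr c * T ^ (m + N)) > Z"
  proof (atomize_elim, rule ccontr)
    assume "\<nexists>n. Z < (\<Sum>m<n. real (m + N) powr c * T ^ (m + N))"
    then have "summable (\<lambda>m. real (m + N) powr c * T ^ (m + N))"
      using T by (intro summableI_nonneg_bounded[where x = Z]) (auto simp: not_less)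
    with ns show False by contradiction
  qed
  have "((\<lambda>x. \<Sum>m<n. ?a m x) \<longlongrightarrow> (\<Sum>m<n. real (m + N) powr c * inverse 1 * (T * 1) ^ (m + N))) (at_left 1)"
    by (intro tendsto_intros) auto
  then have "\<forall>\<^sub>F x in at_left 1. (\<Sum>m<n. ?a m x) > Z"
    by (rule order_tendstoD) (use n in simp)
  moreover have "\<forall>\<^sub>F x in at_left (1::real). x \<in> {0<..<1}" by (rule eventually_at_leftI[of 0]) auto
  ultimately show "\<forall>\<^sub>F x in at_left 1. Z \<le> (\<Sum>m. ?a m x)"
  proof eventually_elim
    case (elim x)
    \<comment> \<open>T x < 1 gives convergence at x, without which \<open>suminf\<close> could not
      be compared with its partial sums.\<close>
    have "T * x \<le> 1 * x" using T elim by (intro mult_right_mono) auto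
    also have "1 * x < 1" using elim(2) by simp
    finally have "T * x < 1" .
    then have "summable (\<lambda>m. inverse x * (real (m + N) powr c * (T * x) ^ (m + N)))"
      using T elim c by (intro summable_mult summable_powr_mult_power_shift summable_powr_mult_power) auto
    then have "summable (\<lambda>m. ?a m x)" by (simp add: mult_ac)
    then have "(\<Sum>m<n. ?a m x) \<le> (\<Sum>m. ?a m x)"
      using T elim by (intro sum_le_suminf) auto
    then show ?case using elim by linarith
  qed
qed

text \<open>The term at 0 is separate because the bounds start at n = 1. For \<open>rr\<close> it is
  the 1 in 1 + phi; with a factor n or n^2 it vanishes.\<close>

lemma suminf_head_tail:
  fixes g :: "nat \<Rightarrow> real"
  assumes "summable g" "N \<ge> 1"
  shows "suminf g = g 0 + (\<Sum>n=1..N-1. g n) + (\<Sum>m. g (m + N))"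
proof -
  have "{..<N} = insert 0 {1..N-1}" using assms by auto
  then have "(\<Sum>n<N. g n) = g 0 + (\<Sum>n=1..N-1. g n)" by simp
  then show ?thesis using suminf_split_initial_segment[OF assms(1), of N] by simp
qed

lemma power_mult_powr:
  assumes "n > 0"
  shows "real n ^ i * real n powr c = real n powr (real i + c)"
  using assms by (simp add: powr_add powr_realpow)

section \<open>The limit of the bounding ratio\<close>

lemma rr_nonneg:
  assumes "\<forall>j\<in>{1..d}. 0 < p j \<and> p j < 1"
  shows "rr d p n \<ge> 0"
proof -
  have "PP d p > 0" "QQ d p > 0" using assms by (blast intro: PP_pos QQ_pos)+
  then show ?thesis by (auto simp: rr_def intro!: mult_nonneg_nonneg sum_nonneg)
qed

lemma rr_0: "rr d p 0 = 1"
  by (simp add: rr_def)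

text \<open>The exponent \<open>c\<close> is tied to \<open>i\<close> by an equation so that it can
  be matched with the exponents as they are written in the bounds.\<close>

lemma power_mult_rr_upper:
  fixes d p defines "\<alpha> \<equiv> root d (PP d p)"
  assumes d: "d > 0" and p: "\<forall>j\<in>{1..d}. 0 < p j \<and> p j < 1"
    and l: "0 < l" "l < 1" and n: "n \<ge> NN \<alpha> l" and c: "c = real i - (real d - 1) / 2"
  shows "real n ^ i * rr d p n \<le> (MM \<alpha> l / sqrt (2 * pi)) ^ (d - 1) * (real n powr c * TT d p ^ n)"
proof -
  have npos: "n > 0" using n by (auto simp: NN_def)
  have ic: "real i + - (real d - 1) / 2 = c" by (simp add: c field_simps)
  have "rr d p n \<le> (MM \<alpha> l / sqrt (2 * pi)) ^ (d - 1) * (real n powr (- (real d - 1) / 2) * TT d p ^ n)"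
    unfolding \<alpha>_def by (rule rr_upper) (use d p l n in \<open>auto simp: \<alpha>_def\<close>)
  then have "real n ^ i * rr d p n
      \<le> real n ^ i * ((MM \<alpha> l / sqrt (2 * pi)) ^ (d - 1) * (real n powr (- (real d - 1) / 2) * TT d p ^ n))"
    by (intro mult_left_mono) auto
  also have "\<dots> = (MM \<alpha> l / sqrt (2 * pi)) ^ (d - 1) * (real n ^ i * real n powr (- (real d - 1) / 2) * TT d p ^ n)"
    by (simp only: mult_ac)
  also have "real n ^ i * real n powr (- (real d - 1) / 2) = real n powr c"
    unfolding power_mult_powr[OF npos] ic ..
  finally show ?thesis .
qed

lemma power_mult_rr_lower:
  fixes d p defines "\<alpha> \<equiv> root d (PP d p)"
  assumes d: "d > 0" and p: "\<forall>j\<in>{1..d}. 0 < p j \<and> p j < 1"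
    and l: "0 < l" "l < 1" and n: "n \<ge> LL \<alpha> l" and c: "c = real i - (real d - 1) / 2"
  shows "(sqrt (2 * pi) / exp 2) ^ d * KK \<alpha> d l * (real n powr c * TT d p ^ n) \<le> real n ^ i * rr d p n"
proof -
  have npos: "n > 0" using n by (auto simp: LL_def)
  have ic: "real i + - (real d - 1) / 2 = c" by (simp add: c field_simps)
  have "(sqrt (2 * pi) / exp 2) ^ d * KK \<alpha> d l * (real n powr (- (real d - 1) / 2) * TT d p ^ n) \<le> rr d p n"
    unfolding \<alpha>_def by (rule rr_lower) (use d p l n in \<open>auto simp: \<alpha>_def\<close>)
  then have "real n ^ i * ((sqrt (2 * pi) / exp 2) ^ d * KK \<alpha> d l * (real n powr (- (real d - 1) / 2) * TT d p ^ n))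
      \<le> real n ^ i * rr d p n"
    by (intro mult_left_mono) auto
  moreover have "real n ^ i * ((sqrt (2 * pi) / exp 2) ^ d * KK \<alpha> d l * (real n powr (- (real d - 1) / 2) * TT d p ^ n))
    = (sqrt (2 * pi) / exp 2) ^ d * KK \<alpha> d l * (real n ^ i * real n powr (- (real d - 1) / 2) * TT d p ^ n)"
    by (simp only: mult_ac)
  moreover have "real n ^ i * real n powr (- (real d - 1) / 2) = real n powr c"
    unfolding power_mult_powr[OF npos] ic ..
  ultimately show ?thesis by metis
qed

lemma summable_power_mult_rr:
  fixes d p defines "\<alpha> \<equiv> root d (PP d p)"
  assumes d: "d > 0" and p: "\<forall>j\<in>{1..d}. 0 < p j \<and> p j < 1"
    and c: "c = real i - (real d - 1) / 2" and sm: "summable (\<lambda>n. real n powr c * TT d p ^ n)"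
  shows "summable (\<lambda>n. real n ^ i * rr d p n)"
proof (rule summable_comparison_test_ev)
  \<comment> \<open>Summability of the moments does not involve the parameter, so any value in (0,
    1) can be chosen; 1/2 is taken.\<close>
  show "summable (\<lambda>n. (MM \<alpha> (1/2) / sqrt (2 * pi)) ^ (d - 1) * (real n powr c * TT d p ^ n))"
    using sm by (rule summable_mult)
  show "\<forall>\<^sub>F n in sequentially. norm (real n ^ i * rr d p n)
      \<le> (MM \<alpha> (1/2) / sqrt (2 * pi)) ^ (d - 1) * (real n powr c * TT d p ^ n)"
    using eventually_ge_at_top[of "NN \<alpha> (1/2)"]
  proof eventually_elim
    case (elim n)
    have "rr d p n \<ge> 0" by (rule rr_nonneg) (rule p)
    moreover have "real n ^ i * rr d p n \<le> (MM \<alpha> (1/2) / sqrt (2 * pi)) ^ (d - 1) * (real n powr c * TT d p ^ n)"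
      unfolding \<alpha>_def by (rule power_mult_rr_upper) (use d p elim c in \<open>auto simp: \<alpha>_def\<close>)
    ultimately show ?case by simp
  qed
qed

text \<open>The comparison with \<open>rr\<close> is made after the passage to the limit, among
  convergent series at 1. The two lemmas after this one follow the same scheme.\<close>

lemma UB_phi_tendsto:
  fixes d p l defines "\<alpha> \<equiv> root d (PP d p)"
  assumes d: "d > 0" and p: "\<forall>j\<in>{1..d}. 0 < p j \<and> p j < 1" and l: "0 < l" "l < 1"
    and sm: "summable (\<lambda>n. real n powr (- (real d - 1) / 2) * TT d p ^ n)"
  obtains u where "((\<lambda>x. UB_phi d p l x) \<longlongrightarrow> u) (at_left 1)" "(\<Sum>n. rr d p n) \<le> 1 + u"
proof
  let ?N = "NN \<alpha> l"
  let ?A = "(MM \<alpha> l / sqrt (2 * pi)) ^ (d - 1)"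
  let ?c = "- (real d - 1) / 2"
  let ?u = "(\<Sum>n=1..?N-1. rr d p n * 1 ^ n) + ?A * (\<Sum>m. real (m + ?N) powr ?c * TT d p ^ (m + ?N))"
  have T: "TT d p > 0" by (rule TT_pos) (rule p)
  have N: "?N \<ge> 1" by (simp add: NN_def)
  have "((\<lambda>x. \<Sum>m. real (m + ?N) powr ?c * (TT d p * x) ^ (m + ?N))
      \<longlongrightarrow> (\<Sum>m. real (m + ?N) powr ?c * TT d p ^ (m + ?N))) (at_left 1)"
    using tail_series_tendsto[OF T sm tendsto_const, of ?N] by simp
  then show "((\<lambda>x. UB_phi d p l x) \<longlongrightarrow> ?u) (at_left 1)"
    unfolding UB_phi_def Let_def \<alpha>_def[symmetric] by (intro tendsto_intros)
  have smr: "summable (rr d p)"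
  proof -
    have "summable (\<lambda>n. real n ^ 0 * rr d p n)"
      by (rule summable_power_mult_rr[OF d p _ sm]) (simp add: field_simps)
    then show ?thesis by simp
  qed
  have "(\<Sum>m. rr d p (m + ?N)) \<le> (\<Sum>m. ?A * (real (m + ?N) powr ?c * TT d p ^ (m + ?N)))"
  proof (intro suminf_le summable_mult summable_powr_mult_power_shift sm)
    show "rr d p (m + ?N) \<le> ?A * (real (m + ?N) powr ?c * TT d p ^ (m + ?N))" for m
      unfolding \<alpha>_def by (rule rr_upper) (use d p l in auto)
    show "summable (\<lambda>m. rr d p (m + ?N))" using smr by (rule summable_ignore_initial_segment)
  qed
  also have "\<dots> = ?A * (\<Sum>m. real (m + ?N) powr ?c * TT d p ^ (m + ?N))"
    by (intro suminf_mult summable_powr_mult_power_shift sm)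
  finally show "(\<Sum>n. rr d p n) \<le> 1 + ?u"
    using suminf_head_tail[OF smr N] rr_0[of d p] by simp
qed

lemma LB_dphi_tendsto:
  fixes d p l defines "\<alpha> \<equiv> root d (PP d p)"
  assumes d: "d > 0" and p: "\<forall>j\<in>{1..d}. 0 < p j \<and> p j < 1" and l: "0 < l" "l < 1"
    and sm: "summable (\<lambda>n. real n powr (- (real d - 3) / 2) * TT d p ^ n)"
  obtains u where "((\<lambda>x. LB_dphi d p l x) \<longlongrightarrow> u) (at_left 1)" "u \<le> (\<Sum>n. real n * rr d p n)" "u > 0"
proof
  let ?N = "LL \<alpha> l"
  let ?A = "(sqrt (2 * pi) / exp 2) ^ d * KK \<alpha> d l"
  let ?c = "- (real d - 3) / 2"
  let ?S = "\<Sum>m. real (m + ?N) powr ?c * TT d p ^ (m + ?N)"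
  let ?H = "\<Sum>n=1..?N-1. real n * rr d p n * 1 ^ (n - 1)"
  let ?u = "?H + ?A * ?S"
  have T: "TT d p > 0" by (rule TT_pos) (rule p)
  have N: "?N \<ge> 1" by (simp add: LL_def)
  have "PP d p > 0" by (rule PP_pos) (rule p)
  then have a: "\<alpha> > 0" using d by (simp add: \<alpha>_def)
  have "((\<lambda>x. \<Sum>m. real (m + ?N) powr ?c * inverse x * (TT d p * x) ^ (m + ?N)) \<longlongrightarrow> ?S) (at_left 1)"
    by (rule tail_series_tendsto[OF T sm]) (auto intro!: tendsto_eq_intros)
  then show "((\<lambda>x. LB_dphi d p l x) \<longlongrightarrow> ?u) (at_left 1)"
    unfolding LB_dphi_def Let_def \<alpha>_def[symmetric] by (intro tendsto_intros)
  have smr: "summable (\<lambda>n. real n * rr d p n)"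
  proof -
    have "summable (\<lambda>n. real n ^ 1 * rr d p n)"
      by (rule summable_power_mult_rr[OF d p _ sm]) (simp add: field_simps)
    then show ?thesis by simp
  qed
  have "?A * ?S = (\<Sum>m. ?A * (real (m + ?N) powr ?c * TT d p ^ (m + ?N)))"
    by (intro suminf_mult[symmetric] summable_powr_mult_power_shift sm)
  also have "\<dots> \<le> (\<Sum>m. real (m + ?N) * rr d p (m + ?N))"
  proof (intro suminf_le summable_mult summable_powr_mult_power_shift sm)
    show "?A * (real (m + ?N) powr ?c * TT d p ^ (m + ?N)) \<le> real (m + ?N) * rr d p (m + ?N)" for m
    proof -
      have "?A * (real (m + ?N) powr ?c * TT d p ^ (m + ?N)) \<le> real (m + ?N) ^ 1 * rr d p (m + ?N)"
        unfolding \<alpha>_def by (rule power_mult_rr_lower) (use d p l in \<open>simp_all add: field_simps\<close>)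
      then show ?thesis by simp
    qed
    show "summable (\<lambda>m. real (m + ?N) * rr d p (m + ?N))" using smr by (rule summable_ignore_initial_segment)
  qed
  finally show "?u \<le> (\<Sum>n. real n * rr d p n)"
    using suminf_head_tail[OF smr N] by simp
  \<comment> \<open>A strictly positive limit is needed because \<open>LB_dphi\<close> becomes a
    denominator.\<close>
  have "?S > 0"
    using T N by (intro suminf_pos summable_powr_mult_power_shift sm) auto
  moreover have "?A > 0" using KK_pos[OF a l, of d] by simp
  moreover have "?H \<ge> 0"
    by (intro sum_nonneg mult_nonneg_nonneg rr_nonneg p) auto
  ultimately show "?u > 0" by (meson add_nonneg_pos mult_pos_pos)
qed

lemma UB_dphi2_tendsto:
  fixes d p l defines "\<alpha> \<equiv> root d (PP d p)"
  assumes d: "d > 0" and p: "\<forall>j\<in>{1..d}. 0 < p j \<and> p j < 1" and l: "0 < l" "l < 1"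
    and sm: "summable (\<lambda>n. real n powr (- (real d - 5) / 2) * TT d p ^ n)"
  obtains u where "((\<lambda>x. UB_dphi2 d p l x) \<longlongrightarrow> u) (at_left 1)" "(\<Sum>n. real n ^ 2 * rr d p n) \<le> u"
proof
  let ?N = "NN \<alpha> l"
  let ?A = "(MM \<alpha> l / sqrt (2 * pi)) ^ (d - 1)"
  let ?c = "- (real d - 5) / 2"
  let ?S = "\<Sum>m. real (m + ?N) powr ?c * TT d p ^ (m + ?N)"
  let ?u = "(\<Sum>n=1..?N-1. real n ^ 2 * rr d p n * 1 ^ (n - 1)) + ?A * ?S"
  have T: "TT d p > 0" by (rule TT_pos) (rule p)
  have N: "?N \<ge> 1" by (simp add: NN_def)
  have "((\<lambda>x. \<Sum>m. real (m + ?N) powr ?c * inverse x * (TT d p * x) ^ (m + ?N)) \<longlongrightarrow> ?S) (at_left 1)"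
    by (rule tail_series_tendsto[OF T sm]) (auto intro!: tendsto_eq_intros)
  then show "((\<lambda>x. UB_dphi2 d p l x) \<longlongrightarrow> ?u) (at_left 1)"
    unfolding UB_dphi2_def Let_def \<alpha>_def[symmetric] by (intro tendsto_intros)
  have smr: "summable (\<lambda>n. real n ^ 2 * rr d p n)"
    by (rule summable_power_mult_rr[OF d p _ sm]) (simp add: field_simps)
  have "(\<Sum>m. real (m + ?N) ^ 2 * rr d p (m + ?N)) \<le> (\<Sum>m. ?A * (real (m + ?N) powr ?c * TT d p ^ (m + ?N)))"
  proof (intro suminf_le summable_mult summable_powr_mult_power_shift sm)
    show "real (m + ?N) ^ 2 * rr d p (m + ?N) \<le> ?A * (real (m + ?N) powr ?c * TT d p ^ (m + ?N))" for m
      unfolding \<alpha>_def by (rule power_mult_rr_upper) (use d p l in \<open>simp_all add: field_simps\<close>)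
    show "summable (\<lambda>m. real (m + ?N) ^ 2 * rr d p (m + ?N))" using smr by (rule summable_ignore_initial_segment)
  qed
  also have "\<dots> = ?A * ?S"
    by (intro suminf_mult summable_powr_mult_power_shift sm)
  finally show "(\<Sum>n. real n ^ 2 * rr d p n) \<le> ?u"
    using suminf_head_tail[OF smr N] by simp
qed

lemma UB_dphi2_at_top:
  assumes d: "d \<ge> 3" and p: "\<forall>j\<in>{1..d}. 0 < p j \<and> p j < 1" and l: "0 < l" "l < 1"
    and ns: "\<not> summable (\<lambda>n. real n powr (- (real d - 5) / 2) * TT d p ^ n)"
  shows "filterlim (\<lambda>x. UB_dphi2 d p l x) at_top (at_left 1)"
proof -
  let ?\<alpha> = "root d (PP d p)"
  let ?N = "NN ?\<alpha> l"
  let ?A = "(MM ?\<alpha> l / sqrt (2 * pi)) ^ (d - 1)"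
  let ?c = "- (real d - 5) / 2"
  have T: "TT d p > 0" by (rule TT_pos) (rule p)
  have T1: "TT d p \<le> 1" by (rule TT_le_1) (use d p in auto)
  have "PP d p > 0" by (rule PP_pos) (rule p)
  then have a: "?\<alpha> > 0" using d by simp
  then have "MM ?\<alpha> l > 0" using l by (simp add: MM_def)
  then have A: "?A > 0" by simp
  have "filterlim (\<lambda>x. \<Sum>m. real (m + ?N) powr ?c * inverse x * (TT d p * x) ^ (m + ?N)) at_top (at_left 1)"
    by (rule tail_series_at_top[OF T T1 _ ns]) (use d in simp)
  then have lim: "filterlim (\<lambda>x. ?A * (\<Sum>m. real (m + ?N) powr ?c * inverse x * (TT d p * x) ^ (m + ?N))) at_top (at_left 1)"
    by (rule filterlim_tendsto_pos_mult_at_top[OF tendsto_const A])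
  have "((\<lambda>x. \<Sum>n=1..?N-1. real n ^ 2 * rr d p n * x ^ (n - 1)) \<longlongrightarrow> (\<Sum>n=1..?N-1. real n ^ 2 * rr d p n * 1 ^ (n - 1))) (at_left 1)"
    by (intro tendsto_intros)
  from filterlim_tendsto_add_at_top[OF this lim] show ?thesis
    unfolding UB_dphi2_def Let_def .
qed

text \<open>This is where the alternative on \<open>p\<close> and \<open>d\<close> is used. Either T
  < 1 and the factor T^n decides, or T = 1, all \<open>p j\<close> agree, d \<ge> 6 and the exponent
  is at most -3/2.\<close>

lemma summable_powr_mult_TT:
  assumes d: "d \<ge> 3" and p: "\<forall>j\<in>{1..d}. 0 < p j \<and> p j < 1"
    and cond: "(\<exists>i\<in>{1..d}. \<exists>j\<in>{1..d}. p i \<noteq> p j) \<or> d \<ge> 6" and c: "c \<le> - (real d - 3) / 2"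
  shows "summable (\<lambda>n. real n powr c * TT d p ^ n)"
proof -
  have T: "TT d p > 0" by (rule TT_pos) (rule p)
  have T1: "TT d p \<le> 1" by (rule TT_le_1) (use d p in auto)
  show ?thesis
  proof (cases "TT d p = 1")
    case True
    have "p i = p j" if "i \<in> {1..d}" "j \<in> {1..d}" for i j
      by (rule TT_eq_1_imp_eq[OF _ p True that]) (use d in simp)
    then have "d \<ge> 6" using cond by blast
    then have "c < -1" using c by simp
    then show ?thesis using True by (simp add: summable_real_powr_iff)
  next
    case False
    then show ?thesis using T T1 c d by (intro summable_powr_mult_power) auto
  qed
qed

text \<open>The analytic half of the theorem, for any nonnegative solution \<open>f\<close> of the
  renewal equation; probability only has to supply such an \<open>f\<close>. \<open>f 1 > 0\<close>
  makes the first moment positive. The second moment is controlled only when the limit is finite,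
  hence the disjunction.\<close>

lemma ratio_bound_limit:
  assumes d: "d \<ge> 3" and p: "\<forall>j\<in>{1..d}. 0 < p j \<and> p j < 1"
    and l: "0 < lam1" "lam1 < 1" "0 < lam2" "lam2 < 1"
    and cond: "(\<exists>i\<in>{1..d}. \<exists>j\<in>{1..d}. p i \<noteq> p j) \<or> d \<ge> 6"
    and f: "\<And>n. f n \<ge> 0" and f0: "f 0 = 0" and f1: "f 1 > 0"
    and ren: "\<And>n. n > 0 \<Longrightarrow> rr d p n = (\<Sum>i\<le>n. f i * rr d p (n - i))"
  shows "summable (\<lambda>n. real n * f n)"
    and "\<exists>Lim :: ereal. ((\<lambda>x. ereal (UB_dphi2 d p lam1 x / LB_dphi d p lam2 x
           - LB_dphi d p lam2 x / (1 + UB_phi d p lam1 x))) \<longlongrightarrow> Lim) (at_left 1)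
         \<and> (Lim = \<infinity> \<or> summable (\<lambda>n. real n ^ 2 * f n)
             \<and> ereal ((\<Sum>n. real n ^ 2 * f n) / (\<Sum>n. real n * f n)) \<le> Lim)"
proof -
  have d0: "d > 0" using d by simp
  have r: "rr d p n \<ge> 0" for n by (rule rr_nonneg) (rule p)
  have r0: "rr d p 0 = 1" by (rule rr_0)
  have fr: "f n \<le> rr d p n" for n using f r r0 ren f0 by (rule renewal_le)
  have sm1: "summable (\<lambda>n. real n powr (- (real d - 3) / 2) * TT d p ^ n)"
    by (rule summable_powr_mult_TT[OF d p cond]) auto
  have sm0: "summable (\<lambda>n. real n powr (- (real d - 1) / 2) * TT d p ^ n)"
    by (rule summable_powr_mult_TT[OF d p cond]) auto
  have smr1: "summable (\<lambda>n. real n * rr d p n)"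
  proof -
    have "summable (\<lambda>n. real n ^ 1 * rr d p n)"
      by (rule summable_power_mult_rr[OF d0 p _ sm1]) (simp add: field_simps)
    then show ?thesis by simp
  qed
  show smf1: "summable (\<lambda>n. real n * f n)"
    by (rule summable_comparison_test_ev[OF _ smr1]) (use f fr in \<open>auto intro!: always_eventually mult_left_mono\<close>)
  obtain v where v: "((\<lambda>x. UB_phi d p lam1 x) \<longlongrightarrow> v) (at_left 1)" "(\<Sum>n. rr d p n) \<le> 1 + v"
    using UB_phi_tendsto[OF d0 p l(1,2) sm0] by blast
  obtain w where w: "((\<lambda>x. LB_dphi d p lam2 x) \<longlongrightarrow> w) (at_left 1)" "w \<le> (\<Sum>n. real n * rr d p n)" "w > 0"
    using LB_dphi_tendsto[OF d0 p l(3,4) sm1] by blast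
  have smr0: "summable (rr d p)"
  proof -
    have "summable (\<lambda>n. real n ^ 0 * rr d p n)"
      by (rule summable_power_mult_rr[OF d0 p _ sm0]) (simp add: field_simps)
    then show ?thesis by simp
  qed
  have R1: "1 \<le> (\<Sum>n. rr d p n)" using sum_le_suminf[OF smr0, of "{0}"] r r0 by simp
  then have v1: "1 + v > 0" using v(2) by linarith
  have lim2: "((\<lambda>x. LB_dphi d p lam2 x / (1 + UB_phi d p lam1 x)) \<longlongrightarrow> w / (1 + v)) (at_left 1)"
    using v1 by (intro tendsto_intros v w) auto
  show "\<exists>Lim :: ereal. ((\<lambda>x. ereal (UB_dphi2 d p lam1 x / LB_dphi d p lam2 x
           - LB_dphi d p lam2 x / (1 + UB_phi d p lam1 x))) \<longlongrightarrow> Lim) (at_left 1)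
         \<and> (Lim = \<infinity> \<or> summable (\<lambda>n. real n ^ 2 * f n)
             \<and> ereal ((\<Sum>n. real n ^ 2 * f n) / (\<Sum>n. real n * f n)) \<le> Lim)"
  proof (cases "summable (\<lambda>n. real n powr (- (real d - 5) / 2) * TT d p ^ n)")
    case True
    obtain u where u: "((\<lambda>x. UB_dphi2 d p lam1 x) \<longlongrightarrow> u) (at_left 1)" "(\<Sum>n. real n ^ 2 * rr d p n) \<le> u"
      using UB_dphi2_tendsto[OF d0 p l(1,2) True] by blast
    have smr2: "summable (\<lambda>n. real n ^ 2 * rr d p n)"
      by (rule summable_power_mult_rr[OF d0 p _ True]) (simp add: field_simps)
    have smf2: "summable (\<lambda>n. real n ^ 2 * f n)"
      by (rule summable_comparison_test_ev[OF _ smr2]) (use f fr in \<open>auto intro!: always_eventually mult_left_mono\<close>)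
    have DF: "(\<Sum>n. real n * f n) > 0"
      using f f1 by (intro suminf_pos2[OF smf1, of 1]) auto
    have "(\<Sum>n. real n ^ 2 * f n) / (\<Sum>n. real n * f n)
       = (\<Sum>n. real n ^ 2 * rr d p n) / (\<Sum>n. real n * rr d p n) - 2 * (\<Sum>n. real n * rr d p n) / (\<Sum>n. rr d p n)"
      by (rule renewal_moments[OF f r r0 f0 ren smr2 DF])
    also have "\<dots> \<le> u / w - w / (1 + v)"
    proof (rule diff_mono)
      have "0 \<le> (\<Sum>n. real n ^ 2 * rr d p n)" using r by (intro suminf_nonneg smr2) auto
      then show "(\<Sum>n. real n ^ 2 * rr d p n) / (\<Sum>n. real n * rr d p n) \<le> u / w"
        using u(2) w by (intro frac_le) auto
      \<comment> \<open>The factor 2 of the renewal identity is given away here.\<close>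
      show "w / (1 + v) \<le> 2 * (\<Sum>n. real n * rr d p n) / (\<Sum>n. rr d p n)"
        using w v R1 by (intro frac_le) auto
    qed
    finally have le: "(\<Sum>n. real n ^ 2 * f n) / (\<Sum>n. real n * f n) \<le> u / w - w / (1 + v)" .
    have "((\<lambda>x. UB_dphi2 d p lam1 x / LB_dphi d p lam2 x - LB_dphi d p lam2 x / (1 + UB_phi d p lam1 x))
        \<longlongrightarrow> u / w - w / (1 + v)) (at_left 1)"
      using w by (intro tendsto_intros u w lim2) auto
    then show ?thesis using le smf2 by (intro exI[of _ "ereal (u / w - w / (1 + v))"]) simp
  next
    case False
    have top: "filterlim (\<lambda>x. UB_dphi2 d p lam1 x) at_top (at_left 1)"
      by (rule UB_dphi2_at_top[OF d p l(1,2) False])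
    have "((\<lambda>x. inverse (LB_dphi d p lam2 x)) \<longlongrightarrow> inverse w) (at_left 1)"
      using w by (intro tendsto_intros) auto
    from filterlim_tendsto_pos_mult_at_top[OF this _ top]
    have "filterlim (\<lambda>x. UB_dphi2 d p lam1 x / LB_dphi d p lam2 x) at_top (at_left 1)"
      using w by (simp add: field_simps)
    from filterlim_tendsto_add_at_top[OF tendsto_minus[OF lim2] this]
    have "filterlim (\<lambda>x. UB_dphi2 d p lam1 x / LB_dphi d p lam2 x
        - LB_dphi d p lam2 x / (1 + UB_phi d p lam1 x)) at_top (at_left 1)" by simp
    then show ?thesis by (intro exI[of _ "\<infinity>"]) (simp add: tendsto_PInfty_eq_at_top)
  qed
qed

section \<open>The rencontre time as a renewal time\<close>

lemma count_split:
  "m \<le> n \<Longrightarrow> card {k\<in>{1..n::nat}. Q k} = card {k\<in>{1..m}. Q k} + card {k\<in>{m+1..n}. Q k}"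
proof -
  assume "m \<le> n"
  then have "{k\<in>{1..n}. Q k} = {k\<in>{1..m}. Q k} \<union> {k\<in>{m+1..n}. Q k}" by auto
  then show ?thesis by (simp only:) (subst card_Un_disjoint, auto)
qed

locale bernoulli_trials = prob_space M for M :: "'a measure" +
  fixes X :: "nat \<Rightarrow> nat \<Rightarrow> 'a \<Rightarrow> bool" and d :: nat and p :: "nat \<Rightarrow> real"
  assumes X_measurable: "j \<in> {1..d} \<Longrightarrow> k \<ge> 1 \<Longrightarrow> X j k \<in> measurable M (count_space UNIV)"
    and X_indep: "indep_vars (\<lambda>_. count_space UNIV) (\<lambda>(j, k). X j k) ({1..d} \<times> {1..})"
    and X_distr: "j \<in> {1..d} \<Longrightarrow> k \<ge> 1 \<Longrightarrow> distr M (count_space UNIV) (X j k) = measure_pmf (bernoulli_pmf (p j))"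
    and d_pos: "d > 0"
    and p_range: "\<forall>j\<in>{1..d}. 0 < p j \<and> p j < 1"
begin

section \<open>The law of a finite block of trials\<close>

lemma prob_X:
  assumes "j \<in> {1..d}" "k \<ge> 1"
  shows "prob (X j k -` {b} \<inter> space M) = (if b then p j else 1 - p j)"
proof -
  have "prob (X j k -` {b} \<inter> space M) = measure (distr M (count_space UNIV) (X j k)) {b}"
    using X_measurable[OF assms] by (simp add: measure_distr)
  also have "\<dots> = (if b then p j else 1 - p j)"
    using bspec[OF p_range assms(1)] by (simp add: X_distr[OF assms] measure_pmf_single)
  finally show ?thesis .
qed

text \<open>A comprehension rather than an intersection over \<open>A\<close>, so that an empty
  block yields the whole space.\<close>

definition cylinder :: "(nat \<times> nat) set \<Rightarrow> (nat \<times> nat \<Rightarrow> bool) \<Rightarrow> 'a set" where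
  "cylinder A c = {\<omega> \<in> space M. \<forall>(j, k)\<in>A. X j k \<omega> = c (j, k)}"

lemma
  assumes "finite A" "A \<subseteq> {1..d} \<times> {1..}"
  shows cylinder_sets: "cylinder A c \<in> events"
    and prob_cylinder: "prob (cylinder A c) = (\<Prod>(j, k)\<in>A. if c (j, k) then p j else 1 - p j)"
proof -
  have eq: "cylinder A c = (\<Inter>i\<in>A. (\<lambda>(j, k). X j k) i -` {c i} \<inter> space M)" if ne: "A \<noteq> {}"
  proof -
    obtain i0 where "i0 \<in> A" using ne by blast
    then show ?thesis by (auto simp: cylinder_def split_def)
  qed
  have meas: "(\<lambda>(j, k). X j k) i -` {c i} \<inter> space M \<in> events" if "i \<in> A" for i
    using X_measurable[of "fst i" "snd i"] assms(2) that
    by (intro measurable_sets[of _ _ "count_space UNIV"]) (auto simp: split_def)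
  show "cylinder A c \<in> events"
  proof (cases "A = {}")
    case False
    show ?thesis unfolding eq[OF False] using False assms(1) meas by (intro sets.finite_INT) auto
  qed (simp add: cylinder_def)
  show "prob (cylinder A c) = (\<Prod>(j, k)\<in>A. if c (j, k) then p j else 1 - p j)"
  proof (cases "A = {}")
    case True
    then show ?thesis by (simp add: cylinder_def prob_space)
  next
    case False
    have "prob (cylinder A c) = (\<Prod>i\<in>A. prob ((\<lambda>(j, k). X j k) i -` {c i} \<inter> space M))"
      unfolding eq[OF False] by (rule indep_varsD[OF X_indep]) (use False assms in auto)
    also have "\<dots> = (\<Prod>(j, k)\<in>A. if c (j, k) then p j else 1 - p j)"
      using assms(2) by (intro prod.cong refl) (auto simp: prob_X)
    finally show ?thesis .
  qed
qed

text \<open>The offset \<open>a\<close> allows counting to restart after a meeting at time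
  \<open>a\<close>; the law of the block does not depend on it.\<close>

definition block_level :: "nat \<Rightarrow> nat \<Rightarrow> nat \<Rightarrow> 'a set" where
  "block_level a n k = {\<omega> \<in> space M. \<forall>j\<in>{1..d}. card {i\<in>{a+1..a+n}. X j i \<omega>} = k}"

definition block_equal :: "nat \<Rightarrow> nat \<Rightarrow> 'a set" where
  "block_equal a n = {\<omega> \<in> space M. \<forall>i\<in>{1..d}. \<forall>j\<in>{1..d}.
     card {k\<in>{a+1..a+n}. X i k \<omega>} = card {k\<in>{a+1..a+n}. X j k \<omega>}}"

text \<open>The event splits into disjoint cylinders, one for each choice of a k-element success set
  in each of the d sequences. All (n choose k)^d of them have the same probability.\<close>

lemma
  shows block_level_sets: "block_level a n k \<in> events"
    and prob_block_level: "prob (block_level a n k) = QQ d p ^ n * (real (n choose k) ^ d * PP d p ^ k)"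
proof -
  let ?I = "{a+1..a+n}"
  let ?D = "{1..d}"
  let ?F = "PiE ?D (\<lambda>_. {S. S \<subseteq> ?I \<and> card S = k})"
  let ?C = "\<lambda>S. cylinder (?D \<times> ?I) (\<lambda>(j, i). i \<in> S j)"
  have finS: "finite {S. S \<subseteq> ?I \<and> card S = k}" by simp
  have fin: "finite ?F" by (intro finite_PiE finS) auto
  have eq: "block_level a n k = (\<Union>S\<in>?F. ?C S)"
  proof (intro equalityI subsetI)
    fix \<omega> assume w: "\<omega> \<in> block_level a n k"
    \<comment> \<open>The restriction to \<open>?D\<close> fixes the values elsewhere; distinct
      members of \<open>?F\<close> thus differ at some j in \<open>?D\<close>, which makes their
      cylinders disjoint.\<close>
    define S where "S = (\<lambda>j\<in>?D. {i\<in>?I. X j i \<omega>})"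
    have wk: "card {i\<in>?I. X j i \<omega>} = k" if "j \<in> ?D" for j
      using w that unfolding block_level_def by blast
    have "S \<in> ?F" unfolding S_def by (rule restrict_PiE_iff[THEN iffD2]) (use wk in blast)
    moreover have "\<omega> \<in> ?C S" using w unfolding S_def block_level_def cylinder_def by simp
    ultimately show "\<omega> \<in> (\<Union>S\<in>?F. ?C S)" by blast
  next
    fix \<omega> assume "\<omega> \<in> (\<Union>S\<in>?F. ?C S)"
    then obtain S where S: "S \<in> ?F" "\<omega> \<in> ?C S" by blast
    have sp: "\<omega> \<in> space M" using S(2) by (simp add: cylinder_def)
    have "card {i\<in>?I. X j i \<omega>} = k" if "j \<in> ?D" for j
    proof -
      have "S j \<in> {S. S \<subseteq> ?I \<and> card S = k}" using S(1) that by (rule PiE_mem)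
      moreover have "X j i \<omega> \<longleftrightarrow> i \<in> S j" if "i \<in> ?I" for i
        using S(2) \<open>j \<in> ?D\<close> that unfolding cylinder_def by blast
      ultimately have "{i\<in>?I. X j i \<omega>} = S j" by blast
      then show ?thesis using \<open>S j \<in> _\<close> by simp
    qed
    then show "\<omega> \<in> block_level a n k" using sp unfolding block_level_def by blast
  qed
  have disj: "disjoint_family_on ?C ?F"
    unfolding disjoint_family_on_def
  proof (intro ballI impI)
    fix S S' assume S: "S \<in> ?F" "S' \<in> ?F" and ne: "S \<noteq> S'"
    show "?C S \<inter> ?C S' = {}"
    proof (rule ccontr)
      assume "?C S \<inter> ?C S' \<noteq> {}"
      then obtain \<omega> where w: "\<omega> \<in> ?C S" "\<omega> \<in> ?C S'" by blast
      have "S j = S' j" for j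
      proof (cases "j \<in> ?D")
        case True
        then have "S j \<subseteq> ?I" "S' j \<subseteq> ?I" using S PiE_mem by blast+
        moreover have "i \<in> S j \<longleftrightarrow> i \<in> S' j" if "i \<in> ?I" for i
          using w True that unfolding cylinder_def by blast
        ultimately show ?thesis by blast
      next
        case False
        show ?thesis using PiE_arb[OF S(1) False] PiE_arb[OF S(2) False] by simp
      qed
      then show False using ne by auto
    qed
  qed
  have sets: "?C S \<in> events" for S by (rule cylinder_sets) auto
  show "block_level a n k \<in> events" unfolding eq using fin sets by blast
  have qpos: "qq p j > 0" if "j \<in> ?D" for j using p_range that by (auto simp: qq_def)
  have "prob (?C S) = QQ d p ^ n * PP d p ^ k" if S: "S \<in> ?F" for S
  proof -
    have "prob (?C S) = (\<Prod>j\<in>?D. \<Prod>i\<in>?I. if i \<in> S j then p j else 1 - p j)"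
    proof -
      have "prob (?C S) = (\<Prod>(j, i)\<in>?D \<times> ?I. if i \<in> S j then p j else 1 - p j)"
        by (subst prob_cylinder) auto
      then show ?thesis by (simp only: prod.cartesian_product)
    qed
    also have "\<dots> = (\<Prod>j\<in>?D. qq p j ^ n * (p j / qq p j) ^ k)"
    proof (intro prod.cong refl)
      fix j assume j: "j \<in> ?D"
      then have Sj: "S j \<subseteq> ?I" "card (S j) = k" using S PiE_mem by blast+
      have "(\<Prod>i\<in>?I. if i \<in> S j then p j else 1 - p j) = (\<Prod>i\<in>?I. qq p j * (if i \<in> S j then p j / qq p j else 1))"
        using qpos[OF j] by (intro prod.cong refl) (auto simp: qq_def)
      also have "\<dots> = qq p j ^ n * (\<Prod>i\<in>?I. if i \<in> S j then p j / qq p j else 1)"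
        by (simp add: prod.distrib)
      also have "(\<Prod>i\<in>?I. if i \<in> S j then p j / qq p j else 1) = (\<Prod>i\<in>?I \<inter> S j. p j / qq p j)"
        by (rule prod.inter_restrict[symmetric]) simp
      also have "?I \<inter> S j = S j" using Sj by blast
      finally show "(\<Prod>i\<in>?I. if i \<in> S j then p j else 1 - p j) = qq p j ^ n * (p j / qq p j) ^ k"
        using Sj by simp
    qed
    also have "\<dots> = QQ d p ^ n * PP d p ^ k"
      by (simp add: QQ_def PP_def prod.distrib prod_power_distrib)
    finally show ?thesis .
  qed
  then have "prob (block_level a n k) = (\<Sum>S\<in>?F. QQ d p ^ n * PP d p ^ k)"
    unfolding eq using fin sets disj by (subst finite_measure_finite_Union) auto
  moreover have "card ?F = (n choose k) ^ d"
    by (subst card_PiE) (auto simp: n_subsets)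
  ultimately show "prob (block_level a n k) = QQ d p ^ n * (real (n choose k) ^ d * PP d p ^ k)"
    by simp
qed

lemma
  shows block_equal_sets: "block_equal a n \<in> events"
    and prob_block_equal: "prob (block_equal a n) = rr d p n"
proof -
  have one: "1 \<in> {1..d}" using d_pos by simp
  have eq: "block_equal a n = (\<Union>k\<in>{0..n}. block_level a n k)"
  proof (intro equalityI subsetI)
    fix \<omega> assume w: "\<omega> \<in> block_equal a n"
    have "card {k\<in>{a+1..a+n}. X 1 k \<omega>} \<le> card {a+1..a+n}" by (rule card_mono) blast+
    then have "card {k\<in>{a+1..a+n}. X 1 k \<omega>} \<in> {0..n}" by simp
    moreover have "\<omega> \<in> block_level a n (card {k\<in>{a+1..a+n}. X 1 k \<omega>})"
      using w one unfolding block_equal_def block_level_def by blast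
    ultimately show "\<omega> \<in> (\<Union>k\<in>{0..n}. block_level a n k)" by blast
  next
    fix \<omega> assume "\<omega> \<in> (\<Union>k\<in>{0..n}. block_level a n k)"
    then obtain k where "\<omega> \<in> block_level a n k" by blast
    then show "\<omega> \<in> block_equal a n" unfolding block_equal_def block_level_def by simp
  qed
  have disj: "disjoint_family_on (block_level a n) {0..n}"
    unfolding disjoint_family_on_def
  proof (intro ballI impI, rule ccontr)
    fix k l assume "k \<noteq> l" "block_level a n k \<inter> block_level a n l \<noteq> {}"
    then obtain \<omega> where "\<omega> \<in> block_level a n k" "\<omega> \<in> block_level a n l" by blast
    then have "card {i\<in>{a+1..a+n}. X 1 i \<omega>} = k" "card {i\<in>{a+1..a+n}. X 1 i \<omega>} = l"
      using one unfolding block_level_def by blast+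
    then show False using \<open>k \<noteq> l\<close> by simp
  qed
  show "block_equal a n \<in> events" unfolding eq using block_level_sets by blast
  have "prob (block_equal a n) = (\<Sum>k\<in>{0..n}. prob (block_level a n k))"
    unfolding eq using disj block_level_sets by (intro finite_measure_finite_Union) auto
  then show "prob (block_equal a n) = rr d p n"
    by (simp add: prob_block_level rr_def sum_distrib_left)
qed

section \<open>The first meeting and the renewal equation\<close>

definition first_equal :: "nat \<Rightarrow> 'a set" where
  "first_equal n = {\<omega> \<in> space M. rencontre_time d X \<omega> = enat n}"

lemma partial_sums_equal_iff:
  "\<omega> \<in> space M \<Longrightarrow> (\<forall>i\<in>{1..d}. \<forall>j\<in>{1..d}. partial_sum X i n \<omega> = partial_sum X j n \<omega>) \<longleftrightarrow> \<omega> \<in> block_equal 0 n"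
  by (auto simp: partial_sum_def block_equal_def)

lemma rencontre_time_eq_enat_iff:
  assumes "\<omega> \<in> space M"
  shows "rencontre_time d X \<omega> = enat n \<longleftrightarrow> n \<ge> 1 \<and> \<omega> \<in> block_equal 0 n \<and> (\<forall>m\<in>{1..<n}. \<omega> \<notin> block_equal 0 m)"
proof -
  define Q where "Q n \<longleftrightarrow> n \<ge> 1 \<and> \<omega> \<in> block_equal 0 n" for n
  have J: "rencontre_time d X \<omega> = Inf (enat ` Collect Q)"
    unfolding rencontre_time_def partial_sums_equal_iff[OF assms] Q_def image_Collect by (rule arg_cong[of _ _ Inf]) blast
  have "Inf (enat ` Collect Q) = enat n \<longleftrightarrow> Q n \<and> (\<forall>m. Q m \<longrightarrow> n \<le> m)"
  proof
    assume eq: "Inf (enat ` Collect Q) = enat n"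
    \<comment> \<open>The infimum of the empty set is \<infinity>, so a finite infimum is
      attained.\<close>
    then have "enat ` Collect Q \<noteq> {}" by (metis Inf_empty enat.distinct(1) top_enat_def)
    then obtain m where "Q m" by blast
    then have "Inf (enat ` Collect Q) \<in> enat ` Collect Q"
      unfolding Inf_enat_def using LeastI[of "\<lambda>x. x \<in> enat ` Collect Q" "enat m"] by auto
    then have "Q n" unfolding eq by auto
    moreover have "n \<le> m" if "Q m" for m
    proof -
      have "Inf (enat ` Collect Q) \<le> enat m" using that by (intro Inf_lower) simp
      then show ?thesis unfolding eq by simp
    qed
    ultimately show "Q n \<and> (\<forall>m. Q m \<longrightarrow> n \<le> m)" by blast
  next
    assume *: "Q n \<and> (\<forall>m. Q m \<longrightarrow> n \<le> m)"
    show "Inf (enat ` Collect Q) = enat n"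
    proof (rule antisym)
      show "Inf (enat ` Collect Q) \<le> enat n" using * by (intro Inf_lower) simp
      show "enat n \<le> Inf (enat ` Collect Q)" using * by (intro Inf_greatest) auto
    qed
  qed
  also have "\<dots> \<longleftrightarrow> Q n \<and> (\<forall>m\<in>{1..<n}. \<omega> \<notin> block_equal 0 m)"
    unfolding Q_def by (metis atLeastLessThan_iff not_le)
  finally show ?thesis unfolding J Q_def by blast
qed

lemma first_equal_eq:
  "first_equal n = (if n = 0 then {} else block_equal 0 n - (\<Union>m\<in>{1..<n}. block_equal 0 m))"
proof (cases "n = 0")
  case True
  then show ?thesis using rencontre_time_eq_enat_iff by (simp add: first_equal_def)
next
  case False
  have "\<omega> \<in> first_equal n \<longleftrightarrow> \<omega> \<in> block_equal 0 n - (\<Union>m\<in>{1..<n}. block_equal 0 m)" for \<omega>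
  proof (cases "\<omega> \<in> space M")
    case True
    then show ?thesis using False by (simp add: first_equal_def rencontre_time_eq_enat_iff)
  next
    case False
    then show ?thesis by (simp add: first_equal_def block_equal_def)
  qed
  then show ?thesis using False by auto
qed

lemma first_equal_sets: "first_equal n \<in> events"
  unfolding first_equal_eq using block_equal_sets by (auto intro!: sets.Diff sets.finite_UN)

text \<open>All counts agree at time m, so they agree at time n exactly when the increments over m +
  1, ..., n do.\<close>

lemma first_equal_Int_block_equal:
  assumes "m \<le> n"
  shows "first_equal m \<inter> block_equal 0 n = first_equal m \<inter> block_equal m (n - m)"
proof (intro set_eqI)
  fix \<omega>
  have "\<omega> \<in> block_equal 0 n \<longleftrightarrow> \<omega> \<in> block_equal m (n - m)" if w: "\<omega> \<in> first_equal m"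
  proof -
    let ?c = "\<lambda>i A. card {k\<in>A. X i k \<omega>}"
    have sp: "\<omega> \<in> space M" using w by (simp add: first_equal_def)
    have "\<omega> \<in> block_equal 0 m"
      using w rencontre_time_eq_enat_iff[OF sp, of m] unfolding first_equal_def by blast
    then have eqm: "?c i {1..m} = ?c j {1..m}" if "i \<in> {1..d}" "j \<in> {1..d}" for i j
      using that unfolding block_equal_def add_0 by blast
    have "?c i {1..n} = ?c j {1..n} \<longleftrightarrow> ?c i {m+1..n} = ?c j {m+1..n}"
      if "i \<in> {1..d}" "j \<in> {1..d}" for i j
      unfolding count_split[OF assms] eqm[OF that] by (rule add_left_cancel)
    then have "(\<forall>i\<in>{1..d}. \<forall>j\<in>{1..d}. ?c i {1..n} = ?c j {1..n})
        \<longleftrightarrow> (\<forall>i\<in>{1..d}. \<forall>j\<in>{1..d}. ?c i {m+1..n} = ?c j {m+1..n})"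
      by blast
    moreover have "{0+1..0+n} = {1..n}" "{m+1..m+(n-m)} = {m+1..n}" using assms by simp_all
    ultimately show ?thesis unfolding block_equal_def mem_Collect_eq using sp by (simp only:)
  qed
  then show "\<omega> \<in> first_equal m \<inter> block_equal 0 n \<longleftrightarrow> \<omega> \<in> first_equal m \<inter> block_equal m (n - m)" by blast
qed

text \<open>The first event is decided by trials up to time m, the second by later ones, and
  disjoint blocks of independent trials are independent. To apply this, both events are written as
  preimages under the restricted trial arrays.\<close>

lemma prob_first_equal_Int_block_equal:
  "prob (first_equal m \<inter> block_equal m l) = prob (first_equal m) * rr d p l"
proof -
  let ?A = "{1..d} \<times> {1..m}" and ?B = "{1..d} \<times> {m+1..m+l}"
  let ?M = "\<lambda>_::nat \<times> nat. count_space (UNIV :: bool set)"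
  let ?X = "\<lambda>i. case_prod X i"
  define Eq where "Eq a n g \<longleftrightarrow> (\<forall>i\<in>{1..d}. \<forall>j\<in>{1..d}.
      card {k\<in>{a+1..a+n}. g (i, k)} = card {k\<in>{a+1..a+n}. g (j, k)})" for a n and g :: "nat \<times> nat \<Rightarrow> bool"
  have iv: "indep_var (PiM ?A ?M) (\<lambda>\<omega>. restrict (\<lambda>i. ?X i \<omega>) ?A) (PiM ?B ?M) (\<lambda>\<omega>. restrict (\<lambda>i. ?X i \<omega>) ?B)"
  proof (rule indep_var_restrict[OF X_indep])
    show "?A \<inter> ?B = {}" by (auto simp del: atLeastatMost_empty_iff)
    show "?A \<subseteq> {1..d} \<times> {1..}" "?B \<subseteq> {1..d} \<times> {1..}" by (intro Sigma_mono; auto)+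
  qed
  \<comment> \<open>A finite block has a discrete product space, so measurability of
    \<open>SA\<close> and \<open>SB\<close> is immediate.\<close>
  have M: "PiM C ?M = count_space (PiE C (\<lambda>_. UNIV))" if "finite C" for C
    using that by (intro count_space_PiM_finite) auto
  define SA where "SA = {g \<in> PiE ?A (\<lambda>_. UNIV). m \<ge> 1 \<and> Eq 0 m g \<and> (\<forall>n\<in>{1..<m}. \<not> Eq 0 n g)}"
  define SB where "SB = {g \<in> PiE ?B (\<lambda>_. UNIV). Eq m l g}"
  have SA: "SA \<in> sets (PiM ?A ?M)" by (subst M) (auto simp: SA_def)
  have SB: "SB \<in> sets (PiM ?B ?M)" by (subst M) (auto simp: SB_def)
  have Eq_cong: "Eq a n g \<longleftrightarrow> Eq a n g'"
    if "\<And>i k. i \<in> {1..d} \<Longrightarrow> k \<in> {a+1..a+n} \<Longrightarrow> g (i, k) = g' (i, k)" for a n g g'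
  proof -
    have "{k\<in>{a+1..a+n}. g (i, k)} = {k\<in>{a+1..a+n}. g' (i, k)}" if "i \<in> {1..d}" for i
      using \<open>\<And>i k. i \<in> {1..d} \<Longrightarrow> k \<in> {a+1..a+n} \<Longrightarrow> g (i, k) = g' (i, k)\<close>[OF that] by blast
    then show ?thesis unfolding Eq_def by (intro ball_cong refl) (simp only:)
  qed
  have block_Eq: "\<omega> \<in> block_equal a n \<longleftrightarrow> Eq a n (\<lambda>i. ?X i \<omega>)" if "\<omega> \<in> space M" for a n \<omega>
    using that by (simp add: block_equal_def Eq_def)
  \<comment> \<open>\<open>Eq 0 n\<close> reads only trials up to n; for n \<le> m it never meets an
    undefined value of the restriction.\<close>
  have eqA: "Eq 0 n (restrict (\<lambda>i. ?X i \<omega>) ?A) \<longleftrightarrow> \<omega> \<in> block_equal 0 n" if "n \<le> m" "\<omega> \<in> space M" for n \<omega>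
    unfolding block_Eq[OF that(2)] by (rule Eq_cong) (use that(1) in simp)
  have eqB: "Eq m l (restrict (\<lambda>i. ?X i \<omega>) ?B) \<longleftrightarrow> \<omega> \<in> block_equal m l" if "\<omega> \<in> space M" for \<omega>
    unfolding block_Eq[OF that] by (rule Eq_cong) simp
  have preA: "(\<lambda>\<omega>. restrict (\<lambda>i. ?X i \<omega>) ?A) -` SA \<inter> space M = first_equal m"
  proof (intro set_eqI)
    fix \<omega>
    have "restrict (\<lambda>i. ?X i \<omega>) ?A \<in> SA \<longleftrightarrow> rencontre_time d X \<omega> = enat m" if w: "\<omega> \<in> space M"
    proof -
      have "restrict (\<lambda>i. ?X i \<omega>) ?A \<in> PiE ?A (\<lambda>_. UNIV)" by (simp only: restrict_PiE_iff) simp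
      moreover have "(\<forall>n\<in>{1..<m}. \<not> Eq 0 n (restrict (\<lambda>i. ?X i \<omega>) ?A)) \<longleftrightarrow> (\<forall>n\<in>{1..<m}. \<omega> \<notin> block_equal 0 n)"
        by (intro ball_cong refl) (simp only: eqA[OF _ w] atLeastLessThan_iff less_imp_le)
      ultimately show ?thesis
        unfolding SA_def mem_Collect_eq rencontre_time_eq_enat_iff[OF w] eqA[OF order_refl w] by blast
    qed
    then show "\<omega> \<in> (\<lambda>\<omega>. restrict (\<lambda>i. ?X i \<omega>) ?A) -` SA \<inter> space M \<longleftrightarrow> \<omega> \<in> first_equal m"
      unfolding first_equal_def by blast
  qed
  have preB: "(\<lambda>\<omega>. restrict (\<lambda>i. ?X i \<omega>) ?B) -` SB \<inter> space M = block_equal m l"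
  proof (intro set_eqI)
    fix \<omega>
    have "restrict (\<lambda>i. ?X i \<omega>) ?B \<in> SB \<longleftrightarrow> \<omega> \<in> block_equal m l" if "\<omega> \<in> space M"
      unfolding SB_def mem_Collect_eq eqB[OF that] by (simp only: restrict_PiE_iff) simp
    then show "\<omega> \<in> (\<lambda>\<omega>. restrict (\<lambda>i. ?X i \<omega>) ?B) -` SB \<inter> space M \<longleftrightarrow> \<omega> \<in> block_equal m l"
      unfolding block_equal_def by blast
  qed
  have "first_equal m \<inter> block_equal m l
     = (\<lambda>\<omega>. (restrict (\<lambda>i. ?X i \<omega>) ?A, restrict (\<lambda>i. ?X i \<omega>) ?B)) -` (SA \<times> SB) \<inter> space M"
    unfolding preA[symmetric] preB[symmetric] by blast
  then show ?thesis
    using indep_varD[OF iv SA SB] unfolding preA preB prob_block_equal by simp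
qed

lemma first_equal_disjoint: "disjoint_family first_equal"
  by (auto simp: disjoint_family_on_def first_equal_def)

lemma first_equal_0: "first_equal 0 = {}"
  by (simp add: first_equal_eq)

lemma rr_renewal:
  assumes "n > 0"
  shows "rr d p n = (\<Sum>m\<le>n. prob (first_equal m) * rr d p (n - m))"
proof -
  have cover: "block_equal 0 n = (\<Union>m\<in>{..n}. first_equal m \<inter> block_equal 0 n)"
  proof (intro equalityI subsetI)
    fix \<omega> assume w: "\<omega> \<in> block_equal 0 n"
    then have sp: "\<omega> \<in> space M" by (simp add: block_equal_def)
    define m where "m = (LEAST m. m \<ge> 1 \<and> \<omega> \<in> block_equal 0 m)"
    have m: "m \<ge> 1 \<and> \<omega> \<in> block_equal 0 m" unfolding m_def
      by (rule LeastI[of _ n]) (use assms w in auto)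
    have "m \<le> n" unfolding m_def by (rule Least_le) (use assms w in auto)
    moreover have "\<omega> \<notin> block_equal 0 k" if "k \<in> {1..<m}" for k
      using not_less_Least[of k "\<lambda>m. m \<ge> 1 \<and> \<omega> \<in> block_equal 0 m"] that unfolding m_def[symmetric] by auto
    ultimately show "\<omega> \<in> (\<Union>m\<in>{..n}. first_equal m \<inter> block_equal 0 n)"
      using m w sp rencontre_time_eq_enat_iff[OF sp, of m] by (auto simp: first_equal_def)
  qed auto
  have "rr d p n = prob (block_equal 0 n)" by (simp add: prob_block_equal)
  also have "\<dots> = prob (\<Union>m\<in>{..n}. first_equal m \<inter> block_equal 0 n)" using cover by simp
  also have "\<dots> = (\<Sum>m\<le>n. prob (first_equal m \<inter> block_equal 0 n))"
  proof (rule finite_measure_finite_Union)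
    show "disjoint_family_on (\<lambda>m. first_equal m \<inter> block_equal 0 n) {..n}"
      by (auto simp: disjoint_family_on_def first_equal_def)
  qed (use first_equal_sets block_equal_sets in auto)
  also have "\<dots> = (\<Sum>m\<le>n. prob (first_equal m) * rr d p (n - m))"
    by (intro sum.cong refl) (simp add: first_equal_Int_block_equal prob_first_equal_Int_block_equal)
  finally show ?thesis .
qed

text \<open>At n = 1 the renewal equation reduces to r_1 = f_1, and r_1 = Q (1 + P).\<close>

lemma prob_first_equal_1_pos: "prob (first_equal 1) > 0"
proof -
  have "rr d p 1 = prob (first_equal 1)"
    using rr_renewal[of 1] by (simp add: first_equal_0 rr_def)
  moreover have "rr d p 1 > 0"
    using QQ_pos[OF p_range] PP_pos[OF p_range] by (simp add: rr_def add_pos_pos)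
  ultimately show ?thesis by simp
qed

text \<open>A general set \<open>S\<close> of times serves both conditional means: all of them for J
  < \<infinity>, and those above the threshold.\<close>

lemma
  fixes S :: "nat set"
  defines "A \<equiv> {\<omega> \<in> space M. \<exists>n\<in>S. rencontre_time d X \<omega> = enat n}"
  shows emeasure_rencontre_in: "emeasure M A = (\<Sum>n. ennreal (prob (first_equal n) * indicator S n))"
    and nn_integral_rencontre_in: "(\<integral>\<^sup>+\<omega>. ennreal_of_enat (rencontre_time d X \<omega>) * indicator A \<omega> \<partial>M)
          = (\<Sum>n. ennreal (real n * prob (first_equal n) * indicator S n))"
proof -
  have A: "A = (\<Union>n. if n \<in> S then first_equal n else {})"
    by (auto simp: A_def first_equal_def)
  have "emeasure M A = (\<Sum>n. emeasure M (if n \<in> S then first_equal n else {}))"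
    unfolding A using first_equal_sets first_equal_disjoint
    by (intro suminf_emeasure[symmetric]) (auto simp: disjoint_family_on_def)
  also have "\<dots> = (\<Sum>n. ennreal (prob (first_equal n) * indicator S n))"
    by (intro suminf_cong) (simp add: emeasure_eq_measure indicator_def)
  finally show "emeasure M A = (\<Sum>n. ennreal (prob (first_equal n) * indicator S n))" .
  have "ennreal_of_enat (rencontre_time d X \<omega>) * indicator A \<omega>
      = (\<Sum>n. ennreal (real n * indicator S n) * indicator (first_equal n) \<omega>)" if w: "\<omega> \<in> space M" for \<omega>
  proof (cases "rencontre_time d X \<omega>")
    case (enat m)
    have "(\<lambda>n. ennreal (real n * indicator S n) * indicator (first_equal n) \<omega>)
        = (\<lambda>n. if n = m then ennreal (real m * indicator S m) else 0)"
      using enat w by (auto simp: first_equal_def indicator_def)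
    moreover have "(\<lambda>n. if n = m then ennreal (real m * indicator S m) else 0) sums ennreal (real m * indicator S m)"
      by (rule sums_single)
    ultimately have "(\<Sum>n. ennreal (real n * indicator S n) * indicator (first_equal n) \<omega>) = ennreal (real m * indicator S m)"
      by (simp add: sums_iff)
    then show ?thesis using enat w by (auto simp: A_def indicator_def ennreal_of_nat_eq_real_of_nat)
  next
    \<comment> \<open>The value \<infinity> is harmless: such a point lies outside \<open>A\<close>,
      and \<infinity> times 0 is 0.\<close>
    case infinity
    then show ?thesis by (simp add: A_def first_equal_def)
  qed
  then have "(\<integral>\<^sup>+\<omega>. ennreal_of_enat (rencontre_time d X \<omega>) * indicator A \<omega> \<partial>M)
      = (\<integral>\<^sup>+\<omega>. (\<Sum>n. ennreal (real n * indicator S n) * indicator (first_equal n) \<omega>) \<partial>M)"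
    by (rule nn_integral_cong)
  also have "\<dots> = (\<Sum>n. \<integral>\<^sup>+\<omega>. ennreal (real n * indicator S n) * indicator (first_equal n) \<omega> \<partial>M)"
    using first_equal_sets by (intro nn_integral_suminf) auto
  also have "\<dots> = (\<Sum>n. ennreal (real n * prob (first_equal n) * indicator S n))"
    using first_equal_sets
    by (intro suminf_cong) (simp add: nn_integral_cmult_indicator emeasure_eq_measure mult_ac flip: ennreal_mult)
  finally show "(\<integral>\<^sup>+\<omega>. ennreal_of_enat (rencontre_time d X \<omega>) * indicator A \<omega> \<partial>M)
      = (\<Sum>n. ennreal (real n * prob (first_equal n) * indicator S n))" .
qed

end

section \<open>The conditional mean\<close>

text \<open>Paley--Zygmund: the part \<open>B\<close> of the first moment above \<open>\<mu> / t\<close> is at least \<open>(1 - 1 / t)\<close> times the whole, and \<open>B\<^sup>2 \<le> (\<Sum>n. n\<^sup>2 * f n) * P\<close> by Cauchy--Schwarz.\<close>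

lemma mean_above_threshold_le:
  fixes f :: "nat \<Rightarrow> real" and t :: real
  defines "e1 \<equiv> \<Sum>n. real n * f n" and "e2 \<equiv> \<Sum>n. real n ^ 2 * f n"
  assumes f: "\<And>n. f n \<ge> 0" and f1: "f 1 > 0" and t: "t > 1"
    and sm0: "summable f" and sm1: "summable (\<lambda>n. real n * f n)" and sm2: "summable (\<lambda>n. real n ^ 2 * f n)"
  defines "S \<equiv> {n. e1 / (\<Sum>n. f n) / t < real n}"
  shows "(\<Sum>n. f n * indicator S n) > 0"
    and "(\<Sum>n. real n * f n * indicator S n) / (\<Sum>n. f n * indicator S n) \<le> t^2 / (t - 1)^2 * (e2 / e1)"
proof -
  define e0 where "e0 = (\<Sum>n. f n)"
  have e0: "e0 > 0" unfolding e0_def using f f1 by (intro suminf_pos2[OF sm0, of 1]) auto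
  have e1: "e1 > 0" unfolding e1_def using f f1 by (intro suminf_pos2[OF sm1, of 1]) auto
  have ind: "summable (\<lambda>n. g n * indicator S n)" if "summable g" "\<And>n. g n \<ge> 0" for g :: "nat \<Rightarrow> real"
    by (rule summable_comparison_test_ev[OF _ that(1)]) (use that(2) in \<open>auto simp: indicator_def intro!: always_eventually\<close>)
  have s0: "summable (\<lambda>n. f n * indicator S n)" by (rule ind[OF sm0 f])
  have s1: "summable (\<lambda>n. real n * f n * indicator S n)" by (rule ind[OF sm1]) (use f in auto)
  have s2: "summable (\<lambda>n. real n ^ 2 * f n * indicator S n)" by (rule ind[OF sm2]) (use f in auto)
  define P where "P = (\<Sum>n. f n * indicator S n)"
  define B where "B = (\<Sum>n. real n * f n * indicator S n)"
  define E where "E = (\<Sum>n. real n ^ 2 * f n * indicator S n)"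
  have "e1 - B = (\<Sum>n. real n * f n - real n * f n * indicator S n)"
    unfolding e1_def B_def by (rule suminf_diff[OF sm1 s1])
  also have "\<dots> \<le> (\<Sum>n. e1 / e0 / t * f n)"
  proof (rule suminf_le)
    show "real n * f n - real n * f n * indicator S n \<le> e1 / e0 / t * f n" for n
    proof (cases "n \<in> S")
      case True
      then show ?thesis using e0 e1 t f by simp
    next
      case False
      then have "real n \<le> e1 / e0 / t" by (simp add: S_def e0_def)
      then have "real n * f n \<le> e1 / e0 / t * f n" using f by (rule mult_right_mono)
      then show ?thesis using False by simp
    qed
  qed (use sm0 sm1 s1 in \<open>auto intro: summable_diff summable_mult\<close>)
  also have "\<dots> = e1 / e0 / t * e0" unfolding e0_def by (rule suminf_mult[OF sm0])
  also have "\<dots> = e1 / t" using e0 by simp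
  finally have "e1 * (1 - 1 / t) \<le> B" by (simp add: algebra_simps)
  then have B: "e1 * ((t - 1) / t) \<le> B" using t by (simp add: field_simps)
  have B0: "B > 0" using B e1 t by (smt (verit) divide_pos_pos mult_pos_pos)
  \<comment> \<open>Cauchy-Schwarz in its quadratic form. The value s = B / P gives the inequality
    once P > 0 is known.\<close>
  have nonneg: "0 \<le> E - 2 * s * B + s^2 * P" for s
  proof -
    have "(\<lambda>n. real n ^ 2 * f n * indicator S n - 2 * s * (real n * f n * indicator S n) + s^2 * (f n * indicator S n))
        sums (E - 2 * s * B + s^2 * P)"
      unfolding E_def B_def P_def by (intro sums_add sums_diff sums_mult summable_sums s0 s1 s2)
    moreover have "0 \<le> real n ^ 2 * f n * indicator S n - 2 * s * (real n * f n * indicator S n) + s^2 * (f n * indicator S n)" for n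
    proof -
      have "0 \<le> (real n - s)^2 * f n * indicator S n" using f[of n] by simp
      also have "\<dots> = real n ^ 2 * f n * indicator S n - 2 * s * (real n * f n * indicator S n) + s^2 * (f n * indicator S n)"
        by (simp add: power2_eq_square algebra_simps)
      finally show ?thesis .
    qed
    ultimately show ?thesis by (rule sums_le[OF _ sums_zero, rotated])
  qed
  have Ee2: "E \<le> e2" unfolding E_def e2_def
    by (rule suminf_le[OF _ s2 sm2]) (use f in \<open>auto simp: indicator_def\<close>)
  have "P \<ge> 0" unfolding P_def using f by (intro suminf_nonneg s0) auto
  moreover have "P \<noteq> 0"
  proof
    assume "P = 0"
    \<comment> \<open>If P were 0, the form would be linear in s; this s makes it E - 2 (E + 1),
      which is negative.\<close>
    then have "0 \<le> E - 2 * ((E + 1) / B) * B" using nonneg[of "(E + 1) / B"] by simp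
    moreover have "0 \<le> E" unfolding E_def using f by (intro suminf_nonneg s2) auto
    ultimately show False using B0 by simp
  qed
  ultimately have P: "P > 0" by simp
  then show "(\<Sum>n. f n * indicator S n) > 0" by (simp add: P_def)
  have "0 \<le> E - B^2 / P" using nonneg[of "B / P"] P by (simp add: power2_eq_square field_simps)
  then have "B^2 \<le> E * P" using P by (simp add: field_simps)
  also have "\<dots> \<le> e2 * P" using Ee2 P by simp
  finally have BP: "B / P \<le> e2 / B" using P B0 by (simp add: field_simps power2_eq_square)
  have e2: "0 \<le> e2" unfolding e2_def using f by (intro suminf_nonneg sm2) auto
  have "e2 / B \<le> e2 / (e1 * ((t - 1) / t))"
    using B B0 e1 t e2 by (intro divide_left_mono mult_pos_pos) auto
  also have "\<dots> = t / (t - 1) * (e2 / e1)" using t e1 by (simp add: field_simps)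
  \<comment> \<open>The argument yields the first power of t / (t - 1), a number above 1; squaring
    gives the stated constant.\<close>
  also have "\<dots> \<le> (t / (t - 1))^2 * (e2 / e1)"
    using t e1 e2 by (intro mult_right_mono self_le_power) auto
  finally have "B / P \<le> t^2 / (t - 1)^2 * (e2 / e1)" using BP by (simp add: power_divide)
  then show "(\<Sum>n. real n * f n * indicator S n) / (\<Sum>n. f n * indicator S n) \<le> t^2 / (t - 1)^2 * (e2 / e1)"
    unfolding B_def P_def .
qed

context bernoulli_trials begin

lemma summable_prob_first_equal: "summable (\<lambda>n. prob (first_equal n))"
  using finite_measure_UNION[of first_equal] first_equal_sets first_equal_disjoint
  by (auto simp: sums_iff)

text \<open>Summability and a positive denominator turn the extended nonnegative quotient into a
  real one.\<close>

lemma cond_exp_rencontre_in: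
  assumes sm: "summable (\<lambda>n. real n * prob (first_equal n))"
    and pos: "(\<Sum>n. prob (first_equal n) * indicator S n) > 0"
    and A: "A = {\<omega> \<in> space M. \<exists>n\<in>S. rencontre_time d X \<omega> = enat n}"
  shows "cond_exp_event M (\<lambda>\<omega>. ennreal_of_enat (rencontre_time d X \<omega>)) A
    = ennreal ((\<Sum>n. real n * prob (first_equal n) * indicator S n) / (\<Sum>n. prob (first_equal n) * indicator S n))"
proof -
  have s0: "summable (\<lambda>n. prob (first_equal n) * indicator S n)"
    by (rule summable_comparison_test_ev[OF _ summable_prob_first_equal]) (auto simp: indicator_def intro!: always_eventually)
  have s1: "summable (\<lambda>n. real n * prob (first_equal n) * indicator S n)"
    by (rule summable_comparison_test_ev[OF _ sm]) (auto simp: indicator_def intro!: always_eventually)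
  have "emeasure M A = ennreal (\<Sum>n. prob (first_equal n) * indicator S n)"
    unfolding A emeasure_rencontre_in using s0 by (intro suminf_ennreal2) auto
  moreover have "(\<integral>\<^sup>+\<omega>. ennreal_of_enat (rencontre_time d X \<omega>) * indicator A \<omega> \<partial>M)
      = ennreal (\<Sum>n. real n * prob (first_equal n) * indicator S n)"
    unfolding A nn_integral_rencontre_in using s1 by (intro suminf_ennreal2) auto
  moreover have "0 \<le> (\<Sum>n. real n * prob (first_equal n) * indicator S n)"
    by (intro suminf_nonneg s1) auto
  ultimately show ?thesis unfolding cond_exp_event_def using pos by (simp add: divide_ennreal)
qed

end

theorem theorem18:
  fixes M :: "'a measure" and X :: "nat \<Rightarrow> nat \<Rightarrow> 'a \<Rightarrow> bool"
    and d :: nat and p :: "nat \<Rightarrow> real" and t lam1 lam2 :: real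
  assumes "prob_space M"
    and "\<And>j k. j \<in> {1..d} \<Longrightarrow> k \<ge> 1 \<Longrightarrow> X j k \<in> measurable M (count_space UNIV)"
    and "prob_space.indep_vars M (\<lambda>_. count_space UNIV) (\<lambda>(j, k). X j k) ({1..d} \<times> {1..})"
    and "\<And>j k. j \<in> {1..d} \<Longrightarrow> k \<ge> 1 \<Longrightarrow>
           distr M (count_space UNIV) (X j k) = measure_pmf (bernoulli_pmf (p j))"
    and "d \<ge> 3"
    and "\<And>j. j \<in> {1..d} \<Longrightarrow> 0 < p j \<and> p j < 1"
    and "t > 1"
    and "0 < lam1" "lam1 < 1" "0 < lam2" "lam2 < 1"
    and "(\<exists>i\<in>{1..d}. \<exists>j\<in>{1..d}. p i \<noteq> p j) \<or> d \<ge> 6"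
  shows "let J = rencontre_time d X;
             \<mu> = cond_exp_event M (\<lambda>\<omega>. ennreal_of_enat (J \<omega>)) {\<omega> \<in> space M. J \<omega> < \<infinity>};
             A = {\<omega> \<in> space M. \<mu> / ennreal t < ennreal_of_enat (J \<omega>) \<and> J \<omega> < \<infinity>}
         in \<exists>Lim :: ereal.
              ((\<lambda>x. ereal (UB_dphi2 d p lam1 x / LB_dphi d p lam2 x
                            - LB_dphi d p lam2 x / (1 + UB_phi d p lam1 x))) \<longlongrightarrow> Lim) (at_left 1)
            \<and> enn2ereal (cond_exp_event M (\<lambda>\<omega>. ennreal_of_enat (J \<omega>)) A)
                \<le> ereal (t^2 / (t - 1)^2) * Lim"
proof -
  have p: "\<forall>j\<in>{1..d}. 0 < p j \<and> p j < 1" using assms(6) by blast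
  have d: "d > 0" using assms(5) by simp
  interpret bernoulli_trials M X d p
    by (intro bernoulli_trials.intro bernoulli_trials_axioms.intro assms(1-4) p d)
  define f where "f n = prob (first_equal n)" for n
  define J where "J = rencontre_time d X"
  define e0 where "e0 = (\<Sum>n. f n)"
  define e1 where "e1 = (\<Sum>n. real n * f n)"
  define \<mu> where "\<mu> = cond_exp_event M (\<lambda>\<omega>. ennreal_of_enat (J \<omega>)) {\<omega> \<in> space M. J \<omega> < \<infinity>}"
  define A where "A = {\<omega> \<in> space M. \<mu> / ennreal t < ennreal_of_enat (J \<omega>) \<and> J \<omega> < \<infinity>}"
  define S where "S = {n. e1 / e0 / t < real n}"
  have f: "f n \<ge> 0" for n by (simp add: f_def)
  have f0: "f 0 = 0" by (simp add: f_def first_equal_0)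
  have f1: "f 1 > 0" unfolding f_def by (rule prob_first_equal_1_pos)
  have ren: "rr d p n = (\<Sum>i\<le>n. f i * rr d p (n - i))" if "n > 0" for n
    unfolding f_def using rr_renewal[OF that] .
  have sm0: "summable f" unfolding f_def by (rule summable_prob_first_equal)
  note limit = ratio_bound_limit[OF assms(5) p assms(8-12) f f0 f1 ren]
  have sm1: "summable (\<lambda>n. real n * f n)" by (rule limit(1))
  obtain Lim :: ereal where Lim: "((\<lambda>x. ereal (UB_dphi2 d p lam1 x / LB_dphi d p lam2 x
           - LB_dphi d p lam2 x / (1 + UB_phi d p lam1 x))) \<longlongrightarrow> Lim) (at_left 1)"
    and cases: "Lim = \<infinity> \<or> summable (\<lambda>n. real n ^ 2 * f n)
             \<and> ereal ((\<Sum>n. real n ^ 2 * f n) / (\<Sum>n. real n * f n)) \<le> Lim"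
    using limit(2) by blast
  have e0: "e0 > 0" unfolding e0_def using f f1 by (intro suminf_pos2[OF sm0, of 1]) auto
  have e1: "e1 > 0" unfolding e1_def using f f1 by (intro suminf_pos2[OF sm1, of 1]) auto
  have c: "t^2 / (t - 1)^2 > 0" using assms(7) by simp
  have \<mu>: "\<mu> = ennreal (e1 / e0)"
  proof -
    have eq: "{\<omega> \<in> space M. J \<omega> < \<infinity>} = {\<omega> \<in> space M. \<exists>n\<in>UNIV. rencontre_time d X \<omega> = enat n}"
      by (auto simp: J_def)
    show ?thesis
      unfolding \<mu>_def eq unfolding J_def
      using cond_exp_rencontre_in[OF sm1[unfolded f_def] _ refl, of UNIV] e0
      by (simp add: e0_def e1_def f_def)
  qed
  have A_eq: "A = {\<omega> \<in> space M. \<exists>n\<in>S. rencontre_time d X \<omega> = enat n}"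
  proof -
    \<comment> \<open>\<mu> is the real number e1 / e0, so the threshold in the conditioning event
      becomes an inequality between reals.\<close>
    have "\<mu> / ennreal t < ennreal_of_enat (enat n) \<longleftrightarrow> n \<in> S" for n
    proof -
      have "\<mu> / ennreal t = ennreal (e1 / e0 / t)"
        unfolding \<mu> using e0 e1 assms(7) by (simp add: divide_ennreal)
      then show ?thesis
        using e0 e1 assms(7) by (simp add: S_def ennreal_of_nat_eq_real_of_nat ennreal_less_iff)
    qed
    then show ?thesis unfolding A_def J_def by fastforce
  qed
  have "enn2ereal (cond_exp_event M (\<lambda>\<omega>. ennreal_of_enat (J \<omega>)) A) \<le> ereal (t^2 / (t - 1)^2) * Lim"
  proof (cases "Lim = \<infinity>")
    case True
    then show ?thesis using c assms(7) by simp
  next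
    case False
    then have sm2: "summable (\<lambda>n. real n ^ 2 * f n)"
      and le: "ereal ((\<Sum>n. real n ^ 2 * f n) / e1) \<le> Lim"
      using cases unfolding e1_def by auto
    have pos: "(\<Sum>n. f n * indicator S n) > 0"
      and bound: "(\<Sum>n. real n * f n * indicator S n) / (\<Sum>n. f n * indicator S n)
        \<le> t^2 / (t - 1)^2 * ((\<Sum>n. real n ^ 2 * f n) / e1)"
      unfolding S_def e0_def e1_def
      by (rule mean_above_threshold_le[OF f f1 assms(7) sm0 sm1 sm2])+
    have s1: "summable (\<lambda>n. real n * f n * indicator S n)"
      by (rule summable_comparison_test_ev[OF _ sm1]) (use f in \<open>auto simp: indicator_def intro!: always_eventually\<close>)
    have "0 \<le> (\<Sum>n. real n * f n * indicator S n)" using f by (intro suminf_nonneg s1) auto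
    then have "enn2ereal (cond_exp_event M (\<lambda>\<omega>. ennreal_of_enat (J \<omega>)) A)
        = ereal ((\<Sum>n. real n * f n * indicator S n) / (\<Sum>n. f n * indicator S n))"
      using cond_exp_rencontre_in[OF sm1[unfolded f_def] pos[unfolded f_def] A_eq] pos
      unfolding J_def f_def by simp
    also have "\<dots> \<le> ereal (t^2 / (t - 1)^2) * ereal ((\<Sum>n. real n ^ 2 * f n) / e1)"
      using bound by simp
    also have "\<dots> \<le> ereal (t^2 / (t - 1)^2) * Lim"
      using le c by (intro ereal_mult_left_mono) auto
    finally show ?thesis .
  qed
  with Lim show ?thesis
    unfolding Let_def J_def[symmetric] \<mu>_def[symmetric] A_def[symmetric] by blast
qed

end
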